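(* Consider an optimal path for Problem (Pc), with optimal control $u$ and node times $0=t_0<t_1<\dots<t_N$. If the signed curvature of the optimal path does not switch between $a$ and $-a$ at the nodes, i.e., if $u(t_i^+)=u(t_i^-)$ for all $i=1,\dots,N-1$, then the total number of $C$ and $S$ subarcs in the optimal path is at most $2N+1$.
   Context: Fix an integer $N\ge1$, a real $a>0$, points $p_i=(x_i,y_i)\in\mathbb{R}^2$, $i=0,\dots,N$, with $p_{i-1}\neq p_i$ for $i=1,\dots,N$, and angles $\theta_0,\theta_f\in\mathbb{R}$. Problem (Pc): minimize $t_N$ over node times $0=t_0<t_1<\dots<t_N$ (free), measurable controls $u:[0,t_N]\to\mathbb{R}$ with $|u(t)|\le a$ a.e., and states $x,y,\theta$ satisfying $\dot x=\cos\theta$, $\dot y=\sin\theta$, $\dot\theta=u$ on $[0,t_N]$, $(x(t_i),y(t_i))=p_i$ for $i=0,\dots,N$, $\theta(0)=\theta_0$, $\theta(t_N)=\theta_f$. The path is $t\mapsto(x(t),y(t))$; $u=\dot\theta$ is its signed curvature. Stage $i$ is the part over $[t_{i-1},t_i]$; the nodes are the points reached at the times $t_i$. An $S$ subarc is a straight line segment ($u=0$), a $C$ subarc is a circular arc with $u\equiv a$ or $u\equiv -a$. In an optimal path the control is piecewise constant with values in $\{a,-a,0\}$, and $u(t_i^\pm)$ denote its one-sided limits at $t_i$. Subarcs are counted along the whole path: maximal pieces on which $u$ is constant count once, even if they contain a node.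
   Formalization: The conditions θ(0)=θ_0 and θ(t_N)=θ_f are imposed modulo 2π (as directions); with equality of real numbers the claim fails, e.g. N=1, a=1, from (0,0) to (10,0), θ_0=0, θ_f=4π, where an optimal path has five subarcs. *)

theory Defs
  imports "HOL-Analysis.Analysis" "HOL-Library.Real_Mod"
begin

text \<open>
  The control is only measurable, so \<open>\<theta>' = u\<close> is meant in the sense of Caratheodory, that is, as
  an integral equation. As \<open>\<theta>\<close> is then continuous, the equations for \<open>x\<close> and \<open>y\<close> hold everywhere.

  The prescribed initial and final angles are directions, so they are compared modulo \<open>2\<pi>\<close>.
  Prescribing the real number \<open>\<theta> (t N)\<close> itself would fix the total rotation of the path:
  for \<open>a = 1\<close> and one stage from \<open>(0, 0)\<close> to \<open>(10, 0)\<close> with angles \<open>0\<close> and \<open>4\<pi>\<close>,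
  any path satisfies \<open>t 1 - 10 = \<integral>(1 - cos \<theta>) \<ge> \<integral>(1 - cos \<theta>) u = 4\<pi>\<close>, with equality for
  a segment into which two full circles are inserted at different interior points: an optimal path
  with five subarcs.
\<close>

definition feasible ::
  "nat \<Rightarrow> real \<Rightarrow> (nat \<Rightarrow> real \<times> real) \<Rightarrow> real \<Rightarrow> real \<Rightarrow>
   (nat \<Rightarrow> real) \<Rightarrow> (real \<Rightarrow> real) \<Rightarrow> (real \<Rightarrow> real) \<Rightarrow> (real \<Rightarrow> real) \<Rightarrow> (real \<Rightarrow> real) \<Rightarrow> bool"
  where
  "feasible N a p \<theta>\<^sub>0 \<theta>\<^sub>f t u x y \<theta> \<longleftrightarrow>
     t 0 = 0 \<and> (\<forall>i\<in>{1..N}. t (i - 1) < t i) \<and>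
     u \<in> borel_measurable (lebesgue_on {0..t N}) \<and>
     (AE s in lebesgue_on {0..t N}. \<bar>u s\<bar> \<le> a) \<and>
     (\<forall>s\<in>{0..t N}. (x has_real_derivative cos (\<theta> s)) (at s within {0..t N})) \<and>
     (\<forall>s\<in>{0..t N}. (y has_real_derivative sin (\<theta> s)) (at s within {0..t N})) \<and>
     (\<forall>s\<in>{0..t N}. (u has_integral (\<theta> s - \<theta> 0)) {0..s}) \<and>
     (\<forall>i\<le>N. (x (t i), y (t i)) = p i) \<and>
     [\<theta> 0 = \<theta>\<^sub>0] (rmod (2 * pi)) \<and>
     [\<theta> (t N) = \<theta>\<^sub>f] (rmod (2 * pi))"

definition optimal ::
  "nat \<Rightarrow> real \<Rightarrow> (nat \<Rightarrow> real \<times> real) \<Rightarrow> real \<Rightarrow> real \<Rightarrow>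
   (nat \<Rightarrow> real) \<Rightarrow> (real \<Rightarrow> real) \<Rightarrow> (real \<Rightarrow> real) \<Rightarrow> (real \<Rightarrow> real) \<Rightarrow> (real \<Rightarrow> real) \<Rightarrow> bool"
  where
  "optimal N a p \<theta>\<^sub>0 \<theta>\<^sub>f t u x y \<theta> \<longleftrightarrow>
     feasible N a p \<theta>\<^sub>0 \<theta>\<^sub>f t u x y \<theta> \<and>
     (\<forall>t' u' x' y' \<theta>'. feasible N a p \<theta>\<^sub>0 \<theta>\<^sub>f t' u' x' y' \<theta>' \<longrightarrow> t N \<le> t' N)"

text \<open>The values at the finitely many breakpoints are left unconstrained.\<close>

definition piecewise_constant_control :: "real \<Rightarrow> real \<Rightarrow> (real \<Rightarrow> real) \<Rightarrow> bool" where
  "piecewise_constant_control a T u \<longleftrightarrow>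
     (\<exists>n \<tau>. \<tau> 0 = 0 \<and> \<tau> n = T \<and> (\<forall>j<n. \<tau> j < \<tau> (Suc j)) \<and>
        (\<forall>j<n. \<exists>k\<in>{a, -a, 0}. \<forall>s\<in>{\<tau> j<..<\<tau> (Suc j)}. u s = k))"

text \<open>
  Constancy is required almost everywhere only, so that an exceptional value of \<open>u\<close> at a single
  time, such as a node time, does not split a piece in two.
\<close>

definition constant_piece :: "real \<Rightarrow> (real \<Rightarrow> real) \<Rightarrow> real \<Rightarrow> real \<Rightarrow> real \<Rightarrow> bool" where
  "constant_piece T u k c d \<longleftrightarrow>
     0 \<le> c \<and> c < d \<and> d \<le> T \<and> (AE s in lebesgue_on {c..d}. u s = k)"

definition maximal_piece :: "real \<Rightarrow> (real \<Rightarrow> real) \<Rightarrow> real \<Rightarrow> real \<Rightarrow> real \<Rightarrow> bool" where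
  "maximal_piece T u k c d \<longleftrightarrow>
     constant_piece T u k c d \<and>
     (\<forall>c' d'. constant_piece T u k c' d' \<and> {c..d} \<subseteq> {c'..d'} \<longrightarrow> {c'..d'} = {c..d})"

text \<open>A subarc is represented by the pair of its initial and final times.\<close>

definition S_subarcs :: "real \<Rightarrow> (real \<Rightarrow> real) \<Rightarrow> (real \<times> real) set" where
  "S_subarcs T u = {(c, d). maximal_piece T u 0 c d}"

definition C_subarcs :: "real \<Rightarrow> real \<Rightarrow> (real \<Rightarrow> real) \<Rightarrow> (real \<times> real) set" where
  "C_subarcs a T u = {(c, d). maximal_piece T u a c d \<or> maximal_piece T u (-a) c d}"

end

theory Submission
  imports Defs
begin

text \<open>
  An optimal path restricted to one stage is a shortest path of bounded curvature between its end
  configurations. Following Dubins, four consecutive pieces with distinct adjacent controls are never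
  optimal: they can be replaced by a strictly shorter sequence of pieces with the same displacement
  and, modulo \<open>2\<pi>\<close>, the same total turning. The replacements are explicit, except in two cases where
  they belong to a one-parameter family of perturbations. So a stage has at most two interior
  switches of the control. The nodes are not switches, which leaves at most \<open>2N\<close> switches in all, and
  a maximal piece is determined by its starting time, which is \<open>0\<close> or a switch.
\<close>

section \<open>Words of arcs and segments\<close>

text \<open>The obstacle is that a replacement must reach exactly the same point and direction,
  three real conditions, and still be strictly shorter. The two outer pieces may be cut down at
  will, so their lengths become parameters, and where possible old and new word are chosen symmetric
  about a mean heading, which leaves a single real equation for the displacement. Four is the right
  number of pieces: if a segment occurs among them, it begins or ends three consecutive pieces that
  already admit a shortcut, whereas the shortcut for three alternating arcs requires a middle arc of
  at most a half circle. For two long middle arcs the fourth piece supplies the missing freedom.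
  Replacements inside a stage keep all nodes on the path, and because consecutive nodes are
  distinct, the new node times are still strictly increasing.\<close>

text \<open>
  A letter \<open>(k, l)\<close> is a piece with control \<open>a k\<close> and duration \<open>l / a\<close>, so that lengths are scaled to
  curvature \<open>1\<close>. The factor \<open>- \<i> k\<close> is \<open>1 / (\<i> k)\<close>, since \<open>k = \<plusminus>1\<close> on an arc.
\<close>

fun word_disp :: "real \<Rightarrow> (real \<times> real) list \<Rightarrow> complex" where
  "word_disp \<phi> [] = 0"
| "word_disp \<phi> ((k, l) # w) =
     (if k = 0 then of_real l * cis \<phi> else - \<i> * of_real k * (cis (\<phi> + k * l) - cis \<phi>))
     + word_disp (\<phi> + k * l) w"

definition word_turn :: "(real \<times> real) list \<Rightarrow> real" where
  "word_turn w = (\<Sum>(k, l)\<leftarrow>w. k * l)"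

definition word_len :: "(real \<times> real) list \<Rightarrow> real" where
  "word_len w = (\<Sum>(k, l)\<leftarrow>w. l)"

text \<open>Lengths may be zero and neighbouring letters may agree, since trimming and the
  replacements can produce such words.\<close>

definition word :: "(real \<times> real) list \<Rightarrow> bool" where
  "word w \<longleftrightarrow> (\<forall>(k, l)\<in>set w. k \<in> {1, -1, 0} \<and> 0 \<le> l)"

text \<open>Initial heading 0 is enough because a displacement rotates with the initial heading.
  Comparing the turning through \<open>cis\<close> allows a full circle to be deleted; all other
  replacements preserve the turning as a real number.\<close>

definition shortenable :: "(real \<times> real) list \<Rightarrow> bool" where
  "shortenable w \<longleftrightarrow> (\<exists>w'. word w' \<and> cis (word_turn w') = cis (word_turn w) \<and>
     word_disp 0 w' = word_disp 0 w \<and> word_len w' < word_len w)"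

lemma word_turn_simps [simp]:
  "word_turn [] = 0" "word_turn ((k, l) # w) = k * l + word_turn w"
  "word_turn (v @ w) = word_turn v + word_turn w" "word_turn (rev w) = word_turn w"
  by (simp_all add: word_turn_def flip: rev_map)

lemma word_len_simps [simp]:
  "word_len [] = 0" "word_len ((k, l) # w) = l + word_len w"
  "word_len (v @ w) = word_len v + word_len w" "word_len (rev w) = word_len w"
  by (simp_all add: word_len_def flip: rev_map)

lemma word_simps [simp]:
  "word []" "word ((k, l) # w) \<longleftrightarrow> k \<in> {1, -1, 0} \<and> 0 \<le> l \<and> word w"
  "word (v @ w) \<longleftrightarrow> word v \<and> word w" "word (rev w) \<longleftrightarrow> word w"
  by (auto simp: word_def)

lemma word_len_nonneg: "word w \<Longrightarrow> 0 \<le> word_len w"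
  by (induction w) auto

lemma word_disp_append:
  "word_disp \<phi> (v @ w) = word_disp \<phi> v + word_disp (\<phi> + word_turn v) w"
  by (induction v arbitrary: \<phi>) (auto simp: add.assoc)

lemma word_disp_rotate: "word_disp (\<phi> + \<psi>) w = cis \<phi> * word_disp \<psi> w"
proof (induction w arbitrary: \<psi>)
  case (Cons x w)
  obtain k l where x: "x = (k, l)" by force
  have "word_disp (\<phi> + \<psi> + k * l) w = cis \<phi> * word_disp (\<psi> + k * l) w"
    using Cons.IH[of "\<psi> + k * l"] by (simp add: add.assoc)
  moreover have "cis (\<phi> + \<psi> + k * l) = cis \<phi> * cis (\<psi> + k * l)"
    by (simp add: cis_mult add.assoc)
  moreover have "cis (\<phi> + \<psi>) = cis \<phi> * cis \<psi>"
    by (simp add: cis_mult)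
  ultimately show ?case
    by (simp add: x algebra_simps diff_divide_distrib)
qed simp

lemma word_disp_eq: "word_disp \<phi> w = cis \<phi> * word_disp 0 w"
  using word_disp_rotate[of \<phi> 0 w] by simp

section \<open>Symmetries: reflection and reversal\<close>

definition mirror :: "(real \<times> real) list \<Rightarrow> (real \<times> real) list" where
  "mirror w = map (\<lambda>(k, l). (- k, l)) w"

lemma mirror_simps [simp]: "mirror [] = []" "mirror ((k, l) # w) = (- k, l) # mirror w"
  by (simp_all add: mirror_def)

lemma word_mirror [simp]:
  "word (mirror w) \<longleftrightarrow> word w" "word_turn (mirror w) = - word_turn w"
  "word_len (mirror w) = word_len w"
proof -
  show "word (mirror w) \<longleftrightarrow> word w"
    by (induction w) (auto simp: minus_equation_iff[of _ 1])
qed (induction w; auto)+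

lemma word_disp_mirror: "word_disp (- \<phi>) (mirror w) = cnj (word_disp \<phi> w)"
proof (induction w arbitrary: \<phi>)
  case (Cons x w)
  obtain k l where x: "x = (k, l)" by force
  have "word_disp (- \<phi> - k * l) (mirror w) = cnj (word_disp (\<phi> + k * l) w)"
    using Cons.IH[of "\<phi> + k * l"] by (simp add: algebra_simps)
  moreover have "cnj (cis (\<phi> + k * l)) = cis (- \<phi> - k * l)" "cnj (cis \<phi>) = cis (- \<phi>)"
    by (simp_all add: cis_cnj)
  ultimately show ?case
    by (auto simp: x field_simps)
qed simp

text \<open>Reversing the order of the pieces is traversing the path backwards followed by a reflection.\<close>

lemma word_disp_rev: "word_disp 0 (rev w) = cis (word_turn w) * cnj (word_disp 0 w)"
proof (induction w)
  case (Cons x w)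
  obtain k l where x: "x = (k, l)" by force
  \<comment> \<open>The chord of a single piece is a real multiple of
    \<open>cis (k * l / 2)\<close>, its mean heading, so conjugation followed by rotation through
    \<open>k * l\<close> fixes it.\<close>
  have eq: "cis (k * l) * cnj (word_disp 0 [x]) = word_disp 0 [x]"
    by (simp add: x cis_cnj cis_mult algebra_simps divide_simps)
  have "word_disp 0 (rev (x # w)) = word_disp 0 (rev w) + word_disp (word_turn w) [x]"
    by (simp add: word_disp_append)
  also have "\<dots> = cis (word_turn w) * (cnj (word_disp 0 w) + word_disp 0 [x])"
    using word_disp_eq[of "word_turn w" "[x]"] by (simp add: Cons.IH algebra_simps)
  also have "\<dots> = cis (word_turn w) * (cis (k * l) * cnj (word_disp 0 [x] + cis (k * l) * word_disp 0 w))"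
    using eq by (simp add: distrib_left cis_cnj cis_mult flip: mult.assoc)
  also have "word_disp 0 [x] + cis (k * l) * word_disp 0 w = word_disp 0 (x # w)"
    using word_disp_eq[of "k * l" w] by (simp add: x)
  finally show ?case
    by (simp add: x cis_mult add.commute flip: mult.assoc)
qed simp

section \<open>Closure properties of shortenable words\<close>

lemma shortenableI:
  assumes "word w'" "word_turn w' = word_turn w" "word_disp 0 w' = word_disp 0 w"
    "word_len w' < word_len w"
  shows "shortenable w"
  using assms unfolding shortenable_def by auto

text \<open>The pieces after \<open>w\<close> see it only through its end point and
  \<open>cis\<close> of its turning, both of which a replacement preserves.\<close>

lemma shortenable_context:
  assumes "shortenable w" "word u" "word v"
  shows "shortenable (u @ w @ v)"
proof -
  obtain w' where w': "word w'" "cis (word_turn w') = cis (word_turn w)"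
    "word_disp 0 w' = word_disp 0 w" "word_len w' < word_len w"
    using assms(1) unfolding shortenable_def by blast
  have "word_disp 0 (u @ w' @ v) = word_disp 0 (u @ w @ v)"
    using w' by (simp add: word_disp_append word_disp_eq[of "_ + _"] word_disp_eq[of "word_turn _"]
        flip: cis_mult)
  moreover have "cis (word_turn (u @ w' @ v)) = cis (word_turn (u @ w @ v))"
    using w' by (simp flip: cis_mult)
  ultimately show ?thesis
    using w' assms unfolding shortenable_def by (intro exI[of _ "u @ w' @ v"]) auto
qed

text \<open>Reflecting the replacement conjugates both displacements, so each construction has to be
  carried out for one orientation only.\<close>

lemma shortenable_mirror:
  assumes "shortenable (mirror w)"
  shows "shortenable w"
proof -
  obtain w' where w': "word w'" "cis (word_turn w') = cis (- word_turn w)"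
    "word_disp 0 w' = word_disp 0 (mirror w)" "word_len w' < word_len w"
    using assms unfolding shortenable_def by auto
  have "word_disp 0 (mirror w') = word_disp 0 w"
    using w'(3) word_disp_mirror[of 0 w'] word_disp_mirror[of 0 w] by simp
  moreover have "cis (- word_turn w') = cis (word_turn w)"
    using w'(2) by (metis cis_cnj minus_minus)
  ultimately show ?thesis
    using w' unfolding shortenable_def by (intro exI[of _ "mirror w'"]) auto
qed

text \<open>By \<open>word_disp_rev\<close> the displacement of a reversed word is determined by the
  displacement and \<open>cis\<close> of the turning, the two quantities that a replacement
  preserves.\<close>

lemma shortenable_rev:
  assumes "shortenable (rev w)"
  shows "shortenable w"
proof -
  obtain w' where w': "word w'" "cis (word_turn w') = cis (word_turn w)"
    "word_disp 0 w' = word_disp 0 (rev w)" "word_len w' < word_len w"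
    using assms unfolding shortenable_def by auto
  have "word_disp 0 (rev w') = word_disp 0 w"
    using w'(2,3) word_disp_rev[of w'] word_disp_rev[of "rev w"] by simp
  then show ?thesis
    using w' unfolding shortenable_def by (intro exI[of _ "rev w'"]) auto
qed

text \<open>Cutting \<open>m\<close> into \<open>m - l\<close> and \<open>l\<close> does not change
  the path, and the surplus is mere context. This is what makes the lengths of the outer letters
  free parameters.\<close>

lemma shortenable_trim:
  assumes "shortenable ((k, l) # w @ [(k', l')])" "k \<in> {1, -1, 0}" "k' \<in> {1, -1, 0}"
    "l \<le> m" "l' \<le> m'"
  shows "shortenable ((k, m) # w @ [(k', m')])"
proof -
  have split: "word_disp \<phi> [(j, p), (j, q)] = word_disp \<phi> [(j, p + q)]" for \<phi> j p q
    by (simp add: algebra_simps add_divide_distrib diff_divide_distrib)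
  let ?v = "[(k, m - l)] @ ((k, l) # w @ [(k', l')]) @ [(k', m' - l')]"
  have "shortenable ?v"
    using assms by (intro shortenable_context) auto
  moreover have "word_turn ?v = word_turn ((k, m) # w @ [(k', m')])"
    "word_len ?v = word_len ((k, m) # w @ [(k', m')])"
    by (auto simp: algebra_simps)
  moreover have "word_disp 0 ?v = word_disp 0 ((k, m) # w @ [(k', m')])"
  proof -
    have "word_disp 0 ?v = word_disp 0 ([(k, m - l), (k, l)] @ w @ [(k', l'), (k', m' - l')])"
      by simp
    also have "\<dots> = word_disp 0 ([(k, m)] @ w @ [(k', m')])"
      unfolding word_disp_append split by (simp add: algebra_simps)
    finally show ?thesis by simp
  qed
  ultimately show ?thesis
    unfolding shortenable_def by metis
qed

lemma shortenable_loop: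
  assumes "2 * pi \<le> l" "k = 1 \<or> k = -1"
  shows "shortenable [(k, l)]"
proof -
  have "cis (k * (l - 2 * pi)) = cis (k * l)"
    using assms by (auto simp: complex_eq_iff cos_diff sin_diff cos_add sin_add)
  then show ?thesis
    using assms unfolding shortenable_def by (intro exI[of _ "[(k, l - 2 * pi)]"]) auto
qed

section \<open>Shortening words\<close>

lemma cis_plus_cis: "cis (x + y) + cis (x - y) = 2 * of_real (cos y) * cis x"
  by (simp add: complex_eq_iff cos_add cos_diff sin_add sin_diff)

text \<open>The right-hand side is the displacement of a left turn of curvature 1 from heading
  \<open>x - y\<close> to \<open>x + y\<close>: its chord points along the mean heading and has
  signed length \<open>2 * sin y\<close>. \<open>cis_plus_cis\<close> does the same for two unit
  segments.\<close>

lemma cis_minus_cis: "2 * of_real (sin y) * cis x = - \<i> * (cis (x + y) - cis (x - y))"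
  by (simp add: complex_eq_iff cos_add cos_diff sin_add sin_diff)

text \<open>Strictness comes from halving the angle:
  \<open>sin x = 2 * sin (x / 2) * cos (x / 2)\<close> with \<open>cos (x / 2) < 1\<close>.\<close>

lemma sin_less_self:
  assumes "0 < (x::real)"
  shows "sin x < x"
proof (cases "x < 2")
  case True
  have "0 < sin (x / 2)"
    using assms True pi_gt3 by (intro sin_gt_zero) auto
  have "cos (x / 2) < cos 0"
    using assms True pi_gt3 by (intro cos_monotone_0_pi) auto
  have "sin x = 2 * sin (x / 2) * cos (x / 2)"
    using sin_double[of "x / 2"] by simp
  also have "\<dots> < 2 * sin (x / 2) * 1"
    using \<open>0 < sin (x / 2)\<close> \<open>cos (x / 2) < cos 0\<close> by (intro mult_strict_left_mono) auto
  also have "\<dots> \<le> x"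
    using sin_x_le_x[of "x / 2"] assms by simp
  finally show ?thesis .
next
  case False
  then show ?thesis using sin_le_one[of x] by linarith
qed

lemma self_less_tan:
  assumes "0 < x" "x < pi / 2"
  shows "x < tan x"
proof -
  have "\<exists>z>0. z < x \<and> tan x - tan 0 = (x - 0) * inverse ((cos z)\<^sup>2)"
  proof (intro MVT2 DERIV_tan)
    fix z assume "0 \<le> z" "z \<le> x"
    then have "0 < cos z"
      using assms by (intro cos_gt_zero_pi) auto
    then show "cos z \<noteq> 0" by simp
  qed (use assms in auto)
  then obtain z where z: "0 < z" "z < x" "tan x = x * inverse ((cos z)\<^sup>2)" by auto
  have "0 < cos z" "cos z < 1"
    using z assms cos_gt_zero_pi[of z] cos_monotone_0_pi[of 0 z] by auto
  then have "1 < inverse ((cos z)\<^sup>2)"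
    by (simp add: one_less_inverse_iff power_less_one_iff)
  then show ?thesis
    using z assms by simp
qed

section \<open>Replacements in closed form\<close>

text \<open>The two halves of the arc keep their headings and move to the ends. The segments, of
  headings 0 and \<open>2 * h\<close>, add up to one of heading \<open>h\<close> and length
  \<open>2 * s * cos h\<close>, which fits between the halves; \<open>h \<le> pi / 2\<close> makes
  this length nonnegative.\<close>

lemma shortenable_SCS_small:
  assumes "0 < s" "0 < h" "h \<le> pi / 2"
  shows "shortenable [(0, s), (1, 2 * h), (0, s)]"
proof (rule shortenableI)
  let ?w' = "[(1, h), (0, 2 * s * cos h), (1, h)]"
  have "0 \<le> cos h"
    using assms by (intro cos_ge_zero) auto
  then show "word ?w'"
    using assms by simp
  have "cis (2 * h) = 2 * of_real (cos h) * cis h - 1"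
    using cis_plus_cis[of h h] by (simp add: algebra_simps)
  then have "of_real s * (2 * of_real (cos h) * cis h) = of_real s * (1 + cis (2 * h))"
    by simp
  then show "word_disp 0 ?w' = word_disp 0 [(0, s), (1, 2 * h), (0, s)]"
    by (simp add: field_simps)
  have "cos h < cos 0"
    using assms by (intro cos_monotone_0_pi) auto
  then show "word_len ?w' < word_len [(0, s), (1, 2 * h), (0, s)]"
    using assms by simp
qed simp

text \<open>
  For an arc longer than \<open>\<pi>\<close> the segments are replaced by opposite turns. To first order the length
  does not change, and the gain comes from the strict concavity of \<open>sin\<close> on \<open>[0, \<pi>]\<close>.
\<close>

lemma shortenable_SCS_large:
  assumes "0 < s" "pi / 2 < h" "h < pi"
  shows "shortenable [(0, s), (1, 2 * h), (0, s)]"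
proof -
  have ch: "cos h < 0"
    using assms cos_monotone_0_pi[of "pi / 2" h] by simp
  \<comment> \<open>The first bound keeps \<open>h + e\<close> below \<open>pi\<close>, where
    \<open>cos\<close> is monotone; the second yields \<open>r \<le> s\<close>.\<close>
  define e where "e = min ((pi - h) / 2) (s * (- cos h) / 2)"
  have e: "0 < e" "h + e < pi" "2 * e \<le> s * (- cos h)"
    using assms ch by (auto simp: e_def min_def field_simps mult_pos_neg)
  \<comment> \<open>Old and new word both displace along the mean heading \<open>h\<close>. Equating
    the signed lengths \<open>2 * r * cos h + 2 * sin h\<close> and
    \<open>4 * sin (h + e) - 2 * sin h\<close> determines \<open>r\<close>.\<close>
  define r where "r = 2 * (sin h - sin (h + e)) / (- cos h)"
  have "\<exists>z>h. z < h + e \<and> sin (h + e) - sin h = (h + e - h) * cos z"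
    using e by (intro MVT2) (auto intro!: derivative_eq_intros)
  then obtain z where z: "h < z" "z < h + e" "sin h - sin (h + e) = e * - cos z" by auto
  have "cos z < cos h"
    using z e assms by (intro cos_monotone_0_pi) (use pi_gt_zero in linarith)+
  have "e * - cos z \<le> e * 1"
    using e by (intro mult_left_mono) (use cos_ge_minus_one[of z] in auto)
  then have "r \<le> s"
    using e ch z unfolding r_def by (simp add: field_simps)
  have "2 * e * - cos h < 2 * (sin h - sin (h + e))"
    using e z \<open>cos z < cos h\<close> by simp
  then have r2: "2 * e < r"
    using ch unfolding r_def by (simp add: field_simps)
  have "shortenable [(0, r), (1, 2 * h), (0, r)]"
  proof (rule shortenableI)
    let ?w' = "[(-1, e), (1, 2 * h + 2 * e), (-1, e)]"
    show "word ?w'" using e assms pi_gt_zero by simp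
    have 1: "1 + cis (2 * h) = 2 * of_real (cos h) * cis h"
      using cis_plus_cis[of h h] by (simp add: add.commute)
    have 2: "2 * of_real (sin h) * cis h = - \<i> * (cis (2 * h) - 1)"
      using cis_minus_cis[of h h] by simp
    have 3: "2 * of_real (sin (h + e)) * cis h = - \<i> * (cis (2 * h + e) - cis (- e))"
      using cis_minus_cis[of "h + e" h] by simp
    have "r * cos h = 2 * (sin (h + e) - sin h)"
      using ch unfolding r_def by (simp add: field_simps)
    then have "of_real r * of_real (cos h) * cis h = 2 * of_real (sin (h + e)) * cis h - 2 * of_real (sin h) * cis h"
      by (metis of_real_diff of_real_mult of_real_numeral left_diff_distrib right_diff_distrib)
    also have "\<dots> = - \<i> * (cis (2 * h + e) - cis (- e) - cis (2 * h) + 1)"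
      unfolding 2 3 by (simp add: algebra_simps)
    finally have *: "of_real r * of_real (cos h) * cis h = - \<i> * (cis (2 * h + e) - cis (- e) - cis (2 * h) + 1)" .
    have "of_real r * (2 * of_real (cos h) * cis h) = 2 * (of_real r * of_real (cos h) * cis h)"
      by simp
    also have "\<dots> = - 2 * \<i> * (cis (2 * h + e) - cis (- e) - cis (2 * h) + 1)"
      unfolding * by simp
    finally have "of_real r * (2 * of_real (cos h) * cis h) = - 2 * \<i> * (cis (2 * h + e) - cis (- e) - cis (2 * h) + 1)" .
    then have "of_real r * (1 + cis (2 * h)) = - 2 * \<i> * (cis (2 * h + e) - cis (- e) - cis (2 * h) + 1)"
      by (simp only: 1)
    then show "word_disp 0 ?w' = word_disp 0 [(0, r), (1, 2 * h), (0, r)]"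
      by (simp add: algebra_simps)
    show "word_len ?w' < word_len [(0, r), (1, 2 * h), (0, r)]"
      using r2 by simp
  qed simp
  then show ?thesis
    using shortenable_trim[of 0 r "[(1, 2 * h)]" 0 r s s] \<open>r \<le> s\<close> by simp
qed

lemma shortenable_SCS:
  assumes "0 < s" "0 < l" "0 < s'"
  shows "shortenable [(0, s), (1, l), (0, s')]"
proof (cases "2 * pi \<le> l")
  case True
  then show ?thesis
    using shortenable_context[OF shortenable_loop[of l 1], of "[(0, s)]" "[(0, s')]"] assms by simp
next
  case False
  then have "shortenable [(0, min s s'), (1, 2 * (l / 2)), (0, min s s')]"
    using assms shortenable_SCS_small[of "min s s'" "l / 2"] shortenable_SCS_large[of "min s s'" "l / 2"]
    by (cases "l / 2 \<le> pi / 2") auto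
  then show ?thesis
    using shortenable_trim[of 0 "min s s'" "[(1, l)]" 0 "min s s'" s s'] by simp
qed

text \<open>Shortening both arcs by \<open>d\<close> loses two equal chords of heading
  \<open>l - d / 2\<close> and total length \<open>r = 4 * sin (d / 2)\<close>. They are merged with
  a piece of the segment of the same length: headings 0 and \<open>2 * e = l - d / 2\<close> give
  one segment of heading \<open>e\<close>, inserted into the remaining left turn. It costs at most
  \<open>r\<close> more than the old segment, and \<open>r < 2 * d\<close>, the amount saved on the
  arcs.\<close>

lemma shortenable_SCC_small:
  assumes "0 < s" "0 < l" "l \<le> pi" "0 < m"
  shows "shortenable [(0, s), (1, l), (-1, m)]"
proof -
  \<comment> \<open>\<open>d \<le> l / 2\<close> leaves the heading \<open>e\<close> inside the
    remaining turn of length \<open>l - d\<close>, and \<open>d \<le> s / 2\<close> gives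
    \<open>r < s\<close>.\<close>
  define d where "d = min (l / 2) (min (s / 2) m)"
  have d: "0 < d" "d \<le> l / 2" "d \<le> s / 2" "d \<le> m"
    using assms by (auto simp: d_def)
  define r e where "r = 4 * sin (d / 2)" and "e = l / 2 - d / 4"
  have "0 < sin (d / 2)"
    using d assms by (intro sin_gt_zero) auto
  then have r: "0 < r" "r < 2 * d"
    using sin_less_self[of "d / 2"] d unfolding r_def by auto
  have "0 \<le> cos e"
    using d assms by (intro cos_ge_zero) (auto simp: e_def)
  have "shortenable [(0, r), (1, l), (-1, m)]"
  proof (rule shortenableI)
    let ?w' = "[(1, e), (0, 2 * r * cos e), (1, l - d - e), (-1, m - d)]"
    show "word ?w'"
      using d r \<open>0 \<le> cos e\<close> by (simp add: e_def)
    have "cis (2 * e) = 2 * of_real (cos e) * cis e - 1"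
      using cis_plus_cis[of e e] by (simp add: algebra_simps)
    moreover have "2 * e = l - d / 2" by (simp add: e_def)
    ultimately have 1: "2 * of_real (cos e) * cis e = 1 + cis (l - d / 2)"
      by simp
    have "2 * of_real (sin (d / 2)) * cis (l - d / 2) = - \<i> * (cis l - cis (l - d))"
      using cis_minus_cis[of "d / 2" "l - d / 2"] by simp
    moreover have "of_real r * cis (l - d / 2) = 2 * (2 * of_real (sin (d / 2)) * cis (l - d / 2))"
      by (simp add: r_def)
    ultimately have 2: "of_real r * cis (l - d / 2) = - 2 * \<i> * (cis l - cis (l - d))"
      by simp
    have 3: "of_real r * (2 * of_real (cos e) * cis e) = of_real r - 2 * \<i> * (cis l - cis (l - d))"
      unfolding 1 by (simp add: distrib_left 2)
    then show "word_disp 0 ?w' = word_disp 0 [(0, r), (1, l), (-1, m)]"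
      by (simp add: algebra_simps)
    have "2 * r * cos e \<le> 2 * r"
      using r by (simp add: mult_le_cancel_left2)
    with r have "2 * r * cos e - 2 * d < r" by linarith
    then show "word_len ?w' < word_len [(0, r), (1, l), (-1, m)]"
      by simp
  qed simp
  then show ?thesis
    using shortenable_trim[of 0 r "[(1, l)]" "-1" m s m] r d by simp
qed

text \<open>The outer turns, cut to \<open>d\<close>, are removed, and a segment of heading
  \<open>- h\<close> is put in the middle of the remaining turn \<open>2 * h\<close>. Both words are
  symmetric about this heading, and equating \<open>4 * sin (m / 2) - 2 * sin h\<close> with
  \<open>2 * sin h + r\<close> determines \<open>r\<close>. It is positive because
  \<open>m \<le> pi\<close>, and the gain \<open>4 * d - r\<close> is positive because
  \<open>sin\<close> increases by less than \<open>d\<close> from \<open>h\<close> to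
  \<open>m / 2\<close>.\<close>

lemma shortenable_CCC:
  assumes "0 < l" "0 < m" "m \<le> pi" "0 < l'"
  shows "shortenable [(1, l), (-1, m), (1, l')]"
proof -
  define d where "d = min (m / 4) (min l l')"
  have d: "0 < d" "d \<le> m / 4" "d \<le> l" "d \<le> l'"
    using assms by (auto simp: d_def)
  define h r where "h = m / 2 - d" and "r = 4 * (sin (m / 2) - sin h)"
  have h: "0 < h" "h < m / 2" using d by (auto simp: h_def)
  have "sin h < sin (m / 2)"
    using h assms by (intro sin_monotone_2pi) auto
  then have "0 < r" by (simp add: r_def)
  have "sin (m / 2) - sin h = 2 * sin (d / 2) * cos ((m - d) / 2)"
    using sin_diff_sin[of "m / 2" h] by (simp add: h_def)
  also have "\<dots> \<le> 2 * sin (d / 2) * 1"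
    using d assms by (intro mult_left_mono) (auto intro!: sin_ge_zero)
  also have "\<dots> < d"
    using sin_less_self[of "d / 2"] d by simp
  finally have "r < 4 * d" by (simp add: r_def)
  have "shortenable [(1, d), (-1, m), (1, d)]"
  proof (rule shortenableI)
    let ?w' = "[(-1, h), (0, r), (-1, h)]"
    show "word ?w'" using h \<open>0 < r\<close> by simp
    have *: "2 * of_real (sin (m / 2)) * cis (- h) = - \<i> * (cis d - cis (d - m))"
      using cis_minus_cis[of "m / 2" "- h"] by (simp add: h_def)
    have **: "2 * of_real (sin h) * cis (- h) = - \<i> * (1 - cis (- 2 * h))"
      using cis_minus_cis[of h "- h"] by simp
    have "of_real r * cis (- h) =
        2 * (2 * of_real (sin (m / 2)) * cis (- h)) - 2 * (2 * of_real (sin h) * cis (- h))"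
      by (simp add: r_def algebra_simps)
    also have "\<dots> = - 2 * \<i> * (cis d - cis (d - m)) + 2 * \<i> * (1 - cis (- 2 * h))"
      unfolding * ** by (simp add: algebra_simps)
    finally have "of_real r * cis (- h) = - 2 * \<i> * (cis d - cis (d - m)) + 2 * \<i> * (1 - cis (- 2 * h))" .
    moreover have "- h - h = - 2 * h" "d - m + d = - 2 * h"
      by (simp_all add: h_def)
    ultimately show "word_disp 0 ?w' = word_disp 0 [(1, d), (-1, m), (1, d)]"
      by (simp add: right_diff_distrib left_diff_distrib)
    show "word_turn ?w' = word_turn [(1, d), (-1, m), (1, d)]"
      "word_len ?w' < word_len [(1, d), (-1, m), (1, d)]"
      using \<open>r < 4 * d\<close> by (auto simp: h_def field_simps)
  qed
  then show ?thesis
    using shortenable_trim[of 1 d "[(-1, m)]" 1 d l l'] d by simp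
qed

section \<open>Perturbation arguments for long arcs\<close>

lemma tendsto_arccos_within:
  assumes "(f \<longlongrightarrow> l) F" "l \<in> {-1..1}" "\<forall>\<^sub>F x in F. f x \<in> {-1..1}"
  shows "((\<lambda>x. arccos (f x)) \<longlongrightarrow> arccos l) F"
  using continuous_on_tendsto_compose[OF continuous_on_arccos' assms] .

text \<open>
  Shortening both arcs by \<open>d\<close> displaces the end point, and the segment is replaced by an opposite turn
  \<open>g d\<close> chosen to compensate the component of this displacement normal to the segment. As \<open>g d\<close> is of
  order \<open>\<surd>d\<close>, replacing a segment by this turn costs only \<open>O(d\<^sup>3\<^sup>/\<^sup>2)\<close>, less than the gain of order \<open>d\<close>.
\<close>

lemma shortenable_SCC_large:
  assumes "0 < s" "pi < l" "l < 2 * pi" "0 < m"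
  shows "shortenable [(0, s), (1, l), (-1, m)]"
proof -
  \<comment> \<open>That both words end at the same point is one complex equation: its imaginary
    part is \<open>cos (g d) = 1 - cos l + cos (l - d)\<close>, its real part gives the length
    \<open>q d\<close> of the consumed segment.\<close>
  define g where "g = (\<lambda>d. arccos (1 - cos l + cos (l - d)))"
  define q where "q = (\<lambda>d. 2 * sin (g d) + 2 * (sin (l - d) - sin l))"
  have "sin l < 0"
    using sin_gt_zero[of "l - pi"] assms by (simp add: sin_diff)
  have small: "\<forall>\<^sub>F d in at_right 0. d < c" if "0 < c" for c :: real
    using eventually_at_right_less[of 0] that by (auto simp: eventually_at_right)
  have lim: "((\<lambda>d. 1 - cos l + cos (l - d)) \<longlongrightarrow> 1) (at_right 0)"
    by (auto intro!: tendsto_eq_intros)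
  have "\<forall>\<^sub>F d in at_right 0. -1 < 1 - cos l + cos (l - d)"
    by (rule order_tendstoD(1)[OF lim]) simp
  moreover have "\<forall>\<^sub>F d in at_right 0. d < l - pi"
    using assms by (intro small) simp
  ultimately have "\<forall>\<^sub>F d in at_right 0. 1 - cos l + cos (l - d) \<in> {-1..1}"
    using eventually_at_right_less[of 0]
  proof eventually_elim
    case (elim d)
    have "cos (l - pi) \<le> cos (l - d - pi)"
      using elim assms by (intro cos_monotone_0_pi_le) auto
    with elim show ?case using assms by (simp add: cos_diff)
  qed
  then have g: "(g \<longlongrightarrow> 0) (at_right 0)"
    using tendsto_arccos_within[OF lim] by (simp add: g_def)
  have q: "(q \<longlongrightarrow> 0) (at_right 0)"
    unfolding q_def by (rule tendsto_eq_intros g refl | simp)+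
  have "((\<lambda>d. - sin (l - d / 2) * cos (g d / 2) - sin (g d / 2)) \<longlongrightarrow> - sin l) (at_right 0)"
    by (rule tendsto_eq_intros g refl | simp)+
  then have "\<forall>\<^sub>F d in at_right 0. 0 < - sin (l - d / 2) * cos (g d / 2) - sin (g d / 2)"
    using \<open>sin l < 0\<close> by (intro order_tendstoD(1)) auto
  moreover have "\<forall>\<^sub>F d in at_right 0. g d < 2 * pi - l" "\<forall>\<^sub>F d in at_right 0. q d < s"
    using g q assms by (auto intro!: order_tendstoD(2)[of _ 0])
  moreover have "\<forall>\<^sub>F d in at_right 0. 0 < (d::real)"
    by (rule eventually_at_right_less)
  ultimately have "\<forall>\<^sub>F d in at_right 0. 0 < d \<and> d < m \<and> d < l - pi \<and> q d < s \<and> g d < 2 * pi - l \<and>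
      sin (g d / 2) < - sin (l - d / 2) * cos (g d / 2)"
    using small[of m] small[of "l - pi"] assms by (auto simp: eventually_conj_iff)
  then obtain d where d: "0 < d" "d < m" "d < l - pi" "q d < s" "g d < 2 * pi - l"
      "sin (g d / 2) < - sin (l - d / 2) * cos (g d / 2)"
    using eventually_happens'[OF trivial_limit_at_right_real] by blast
  \<comment> \<open>Each removed arc has mean heading \<open>\<psi>\<close> and chord
    \<open>2 * \<sigma>\<close>, so the equation for \<open>g d\<close> becomes
    \<open>(sin h)\<^sup>2 = \<sigma> * p\<close>.\<close>
  define h \<psi> \<sigma> p where "h = g d / 2" and "\<psi> = l - d / 2" and "\<sigma> = sin (d / 2)" and "p = - sin \<psi>"
  have "0 < \<sigma>"
    using d assms unfolding \<sigma>_def by (intro sin_gt_zero) auto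
  have "\<sigma> < d / 2"
    using d sin_less_self[of "d / 2"] unfolding \<sigma>_def by simp
  have "0 < p"
    using sin_gt_zero[of "\<psi> - pi"] d assms by (simp add: p_def \<psi>_def sin_diff)
  have cc: "cos l - cos (l - d) = 2 * \<sigma> * p"
    using cos_diff_cos[of l "l - d"] by (simp add: \<sigma>_def p_def \<psi>_def diff_divide_distrib)
  have ss: "sin (l - d) - sin l = - 2 * \<sigma> * cos \<psi>"
    using sin_diff_sin[of "l - d" l] by (simp add: \<sigma>_def \<psi>_def diff_divide_distrib)
  have le1: "1 - cos l + cos (l - d) < 1"
    using cc \<open>0 < \<sigma>\<close> \<open>0 < p\<close> by (smt (verit) mult_pos_pos)
  have "cos (l - d) \<ge> -1" "cos l < 1"
    using cos_monotone_0_pi[of 0 "2 * pi - l"] assms by auto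
  have ge: "-1 \<le> 1 - cos l + cos (l - d)"
    using \<open>cos l < 1\<close> cos_ge_minus_one[of "l - d"] by linarith
  have cg: "cos (g d) = 1 - 2 * \<sigma> * p"
    using cos_arccos[of "1 - cos l + cos (l - d)"] le1 ge cc by (simp add: g_def)
  have "g d \<ge> 0"
    using arccos_bounded le1 ge unfolding g_def by simp
  moreover have "g d \<noteq> 0"
    using cg \<open>0 < \<sigma>\<close> \<open>0 < p\<close> by auto
  ultimately have h: "0 < h" "h \<le> pi - \<psi> / 2" "pi - \<psi> / 2 < pi / 2"
    using d assms by (auto simp: h_def \<psi>_def field_simps)
  then have "0 < sin h" "0 < cos h"
    by (auto intro!: sin_gt_zero cos_gt_zero_pi)
  have sh: "(sin h)\<^sup>2 = \<sigma> * p"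
    using cg cos_double_sin[of h] by (simp add: h_def)
  have sg: "sin (g d) = 2 * sin h * cos h"
    using sin_double[of h] by (simp add: h_def)
  have qd: "q d = 4 * sin h * cos h - 4 * \<sigma> * cos \<psi>"
    unfolding q_def sg ss by simp
  have "sin h < p * cos h"
    using d(6) by (simp add: h_def p_def \<psi>_def)
  then have "sin h * sin h < sin h * (p * cos h)"
    using \<open>0 < sin h\<close> by (rule mult_strict_left_mono)
  then have "p * \<sigma> < p * (sin h * cos h)"
    using sh by (simp add: power2_eq_square algebra_simps)
  then have "\<sigma> < sin h * cos h"
    using \<open>0 < p\<close> by simp
  moreover have "\<sigma> * cos \<psi> \<le> \<sigma>"
    using \<open>0 < \<sigma>\<close> by (simp add: mult_le_cancel_left2)
  ultimately have "0 < q d"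
    unfolding qd by linarith
  \<comment> \<open>From \<open>g d < 2 * pi - l\<close> follows
    \<open>h \<le> pi - \<psi> / 2\<close>, so \<open>T\<close> bounds \<open>tan h\<close>, and the
    half-angle formula gives \<open>T * p = 1 - cos \<psi>\<close>. The factor \<open>p\<close>
    cancels, and the cost \<open>h - sin h * cos h\<close> of the turns is bounded by
    \<open>\<sigma> * (1 - cos \<psi>)\<close> for this \<open>d\<close>, not merely
    asymptotically.\<close>
  define T where "T = tan (pi - \<psi> / 2)"
  have "T * p = 1 - cos \<psi>"
  proof -
    let ?x = "pi - \<psi> / 2"
    have "cos ?x \<noteq> 0"
      using cos_gt_zero_pi[of ?x] h by simp
    have "p = sin (2 * ?x)" "cos \<psi> = cos (2 * ?x)"
      by (simp_all add: p_def right_diff_distrib sin_diff cos_diff)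
    then show ?thesis
      using \<open>cos ?x \<noteq> 0\<close> unfolding T_def tan_def sin_double cos_double_sin
      by (simp add: power2_eq_square del: sin_pi_minus cos_pi_minus)
  qed
  have "tan h \<le> T"
    using h unfolding T_def by (intro tan_mono_le) auto
  have "sin h * cos h = tan h * (cos h)\<^sup>2"
    using \<open>0 < cos h\<close> by (simp add: tan_def power2_eq_square)
  then have tan_sin: "tan h - sin h * cos h = tan h * (sin h)\<^sup>2"
    by (simp only: sin_squared_eq right_diff_distrib mult_1_right)
  have "h - sin h * cos h < tan h - sin h * cos h"
    using self_less_tan[of h] h by simp
  also have "\<dots> = tan h * (sin h)\<^sup>2"
    by (rule tan_sin)
  also have "\<dots> \<le> T * (\<sigma> * p)"
    unfolding sh using \<open>tan h \<le> T\<close> \<open>0 < \<sigma>\<close> \<open>0 < p\<close> by (intro mult_right_mono) auto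
  also have "\<dots> = \<sigma> * (1 - cos \<psi>)"
    using \<open>T * p = 1 - cos \<psi>\<close> by (metis mult.left_commute)
  finally have "2 * g d - 2 * d < q d"
    using \<open>\<sigma> < d / 2\<close> unfolding qd by (simp add: h_def algebra_simps)
  have "shortenable [(0, q d), (1, l), (-1, m)]"
  proof (rule shortenableI)
    let ?w' = "[(-1, g d), (1, l - d + g d), (-1, m - d)]"
    show "word ?w'" using d assms \<open>g d \<ge> 0\<close> pi_gt_zero by simp
    have "of_real (q d) = 2 * \<i> * (cis (- g d) - 1 - cis (l - d) + cis l)"
      using cg cc by (simp add: complex_eq_iff q_def)
    then show "word_disp 0 ?w' = word_disp 0 [(0, q d), (1, l), (-1, m)]"
      by (simp add: algebra_simps)
    show "word_len ?w' < word_len [(0, q d), (1, l), (-1, m)]"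
      using \<open>2 * g d - 2 * d < q d\<close> by simp
  qed simp
  then show ?thesis
    using shortenable_trim[of 0 "q d" "[(1, l)]" "-1" m s m] d by simp
qed

lemma shortenable_SCC:
  assumes "0 < s" "0 < l" "0 < m"
  shows "shortenable [(0, s), (1, l), (-1, m)]"
proof (cases "2 * pi \<le> l")
  case True
  then show ?thesis
    using shortenable_context[OF shortenable_loop[of l 1], of "[(0, s)]" "[(-1, m)]"] assms by simp
next
  case False
  then show ?thesis
    using assms shortenable_SCC_small shortenable_SCC_large by (cases "l \<le> pi") auto
qed

text \<open>
  Let \<open>A\<close>, \<open>B\<close>, \<open>C\<close> be the headings at the three switches. The displacement depends only on
  \<open>cis A - cis B + cis C\<close>, and the length is \<open>2 (A - B + C)\<close> up to a constant. Keeping the former fixed,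
  \<open>B\<close> is increased by \<open>b\<close>. Then \<open>P b\<close> is the new value of \<open>cis A + cis C\<close> divided by \<open>cis\<close> of the old
  mean heading \<open>M = (A + C) / 2\<close>, so \<open>M\<close> turns by \<open>Arg (P b)\<close> and the new \<open>(A - C) / 2\<close> has
  cosine \<open>cmod (P b) / 2\<close>. The length decreases if and only if \<open>2 Arg (P b) < b\<close>.
\<close>

lemma shortenable_CCCC_large:
  assumes "0 < l" "pi < \<beta>" "\<beta> < 2 * pi" "pi < \<gamma>" "\<gamma> < 2 * pi" "0 < l'"
  shows "shortenable [(1, l), (-1, \<beta>), (1, \<gamma>), (-1, l')]"
proof -
  \<comment> \<open>In terms of the headings at the switches, \<open>\<mu> = M - B\<close> and
    \<open>n = (A - C) / 2\<close>; hence \<open>cis A + cis C = \<rho> * cis M\<close>.\<close>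
  define \<mu> n where "\<mu> = (\<beta> + \<gamma>) / 2" and "n = (\<beta> - \<gamma>) / 2"
  define M B F where "M = l - n" and "B = l - \<beta>" and "F = l - \<beta> + \<gamma> - l'"
  define \<rho> where "\<rho> = 2 * cos n"
  define P where "P = (\<lambda>b. of_real \<rho> + cis (b - \<mu>) - cis (- \<mu>))"
  \<comment> \<open>\<open>arccos\<close> recovers the half difference only up to sign. With the
    sign of \<open>n\<close>, \<open>f\<close> tends to \<open>n\<close>, so the new arcs tend to
    the old ones and stay positive.\<close>
  define f where "f = (\<lambda>b. (if 0 \<le> n then 1 else -1) * arccos (cmod (P b) / 2))"
  have \<mu>: "pi < \<mu>" "\<mu> < 2 * pi" and n: "- (pi / 2) < n" "n < pi / 2"
    using assms by (auto simp: \<mu>_def n_def)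
  have "0 < \<rho>"
    using cos_gt_zero_pi[of n] n by (simp add: \<rho>_def)
  have "sin \<mu> < 0"
    using sin_gt_zero[of "\<mu> - pi"] \<mu> by (simp add: sin_diff)
  have "0 < sin (\<beta> / 2) * sin (\<gamma> / 2)"
    using assms by (intro mult_pos_pos sin_gt_zero) auto
  then have "2 * cos \<mu> < \<rho>"
    using cos_diff_cos[of n \<mu>] by (simp add: \<rho>_def \<mu>_def n_def field_simps)
  have small: "\<forall>\<^sub>F d in at_right 0. d < c" if "0 < c" for c :: real
    using eventually_at_right_less[of 0] that by (auto simp: eventually_at_right)
  \<comment> \<open>The modulus must not grow: for \<open>n = 0\<close> it starts at 2, the largest
    possible value of \<open>2 * cos (f b)\<close>. The last bracket tends to
    \<open>\<rho> * sin \<mu>\<close>, which is negative because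
    \<open>pi < \<mu> < 2 * pi\<close>.\<close>
  have cP: "(cmod (P b))\<^sup>2 = \<rho>\<^sup>2 + 4 * sin (b / 2) * (\<rho> * sin (\<mu> - b / 2) + sin (b / 2))" for b
  proof -
    have 1: "cos (b - \<mu>) - cos \<mu> = 2 * sin (b / 2) * sin (\<mu> - b / 2)"
      using cos_diff_cos[of "b - \<mu>" \<mu>] sin_minus[of "b / 2 - \<mu>"]
      by (simp add: diff_divide_distrib algebra_simps)
    have 2: "1 - cos b = 2 * (sin (b / 2))\<^sup>2"
      using cos_double_sin[of "b / 2"] by simp
    have 3: "cos b = cos (b - \<mu>) * cos \<mu> - sin (b - \<mu>) * sin \<mu>"
      using cos_add[of "b - \<mu>" \<mu>] by simp
    have "(cmod (P b))\<^sup>2 = (\<rho> + (cos (b - \<mu>) - cos \<mu>))\<^sup>2 + (sin (b - \<mu>) + sin \<mu>)\<^sup>2"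
      by (simp add: P_def cmod_power2 algebra_simps)
    also have "\<dots> = \<rho>\<^sup>2 + 2 * \<rho> * (cos (b - \<mu>) - cos \<mu>)
        + ((cos (b - \<mu>))\<^sup>2 + (sin (b - \<mu>))\<^sup>2) + ((cos \<mu>)\<^sup>2 + (sin \<mu>)\<^sup>2) - 2 * cos b"
      unfolding 3 by (simp add: power2_eq_square algebra_simps)
    also have "\<dots> = \<rho>\<^sup>2 + 2 * \<rho> * (2 * sin (b / 2) * sin (\<mu> - b / 2)) + 2 * (2 * (sin (b / 2))\<^sup>2)"
      unfolding 1[symmetric] 2[symmetric] by simp
    finally show ?thesis
      by (simp add: power2_eq_square algebra_simps)
  qed
  have limP: "(P \<longlongrightarrow> of_real \<rho>) (at_right 0)"
    unfolding P_def by (rule tendsto_eq_intros refl | simp)+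
  have lim_cP: "((\<lambda>b. cmod (P b)) \<longlongrightarrow> \<rho>) (at_right 0)"
    using tendsto_norm[OF limP] \<open>0 < \<rho>\<close> by simp
  have "((\<lambda>b. \<rho> * sin (\<mu> - b / 2) + sin (b / 2)) \<longlongrightarrow> \<rho> * sin \<mu>) (at_right 0)"
    by (rule tendsto_eq_intros refl | simp)+
  then have "\<forall>\<^sub>F b in at_right 0. \<rho> * sin (\<mu> - b / 2) + sin (b / 2) < 0"
    by (rule order_tendstoD(2)) (use \<open>0 < \<rho>\<close> \<open>sin \<mu> < 0\<close> in \<open>simp add: mult_pos_neg\<close>)
  then have ev\<rho>: "\<forall>\<^sub>F b in at_right 0. cmod (P b) \<le> \<rho>"
    using small[OF pi_gt_zero] eventually_at_right_less[of 0]
  proof eventually_elim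
    case (elim b)
    then have "0 < sin (b / 2)" by (intro sin_gt_zero) auto
    then have "(cmod (P b))\<^sup>2 \<le> \<rho>\<^sup>2"
      unfolding cP using elim by (simp add: mult_nonneg_nonpos)
    then show ?case
      using \<open>0 < \<rho>\<close> by (simp add: power2_le_iff_abs_le)
  qed
  have range: "cmod (P b) / 2 \<in> {-1..1}" if "cmod (P b) \<le> \<rho>" for b
    using that cos_le_one[of n] norm_ge_zero[of "P b"] unfolding \<rho>_def by (auto simp del: norm_ge_zero cos_le_one)
  have limf: "(f \<longlongrightarrow> n) (at_right 0)"
  proof -
    have "((\<lambda>b. arccos (cmod (P b) / 2)) \<longlongrightarrow> arccos (cos n)) (at_right 0)"
    proof (rule tendsto_arccos_within)
      show "((\<lambda>b. cmod (P b) / 2) \<longlongrightarrow> cos n) (at_right 0)"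
        using tendsto_divide[OF lim_cP tendsto_const, of 2] by (simp add: \<rho>_def)
      show "\<forall>\<^sub>F b in at_right 0. cmod (P b) / 2 \<in> {-1..1}"
        using ev\<rho> range by (rule eventually_mono)
    qed simp
    moreover have "arccos (cos n) = \<bar>n\<bar>"
      using n arccos_cos[of n] arccos_cos2[of n] by (cases "0 \<le> n") auto
    ultimately have "(f \<longlongrightarrow> (if 0 \<le> n then 1 else -1) * \<bar>n\<bar>) (at_right 0)"
      unfolding f_def by (intro tendsto_mult tendsto_const) simp
    then show ?thesis by (cases "0 \<le> n") auto
  qed
  have limArg: "((\<lambda>b. Arg (P b)) \<longlongrightarrow> 0) (at_right 0)"
    using isCont_tendsto_compose[OF continuous_at_Arg limP] \<open>0 < \<rho>\<close> by simp
  define A1 B1 C1 where "A1 = (\<lambda>b. M + Arg (P b) + f b)" and "B1 = (\<lambda>b. B + b)"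
    and "C1 = (\<lambda>b. M + Arg (P b) - f b)"
  have limA: "(A1 \<longlongrightarrow> l) (at_right 0)" and limB: "(B1 \<longlongrightarrow> l - \<beta>) (at_right 0)"
    and limC: "(C1 \<longlongrightarrow> l - \<beta> + \<gamma>) (at_right 0)"
    unfolding A1_def B1_def C1_def
    by (rule tendsto_eq_intros limArg limf refl | simp add: M_def B_def n_def field_simps)+
  have "\<forall>\<^sub>F b in at_right 0. 0 < A1 b"
    using order_tendstoD(1)[OF limA] assms by simp
  moreover have "\<forall>\<^sub>F b in at_right 0. 0 < A1 b - B1 b"
    using order_tendstoD(1)[OF tendsto_diff[OF limA limB], of 0] assms pi_gt_zero by simp
  moreover have "\<forall>\<^sub>F b in at_right 0. 0 < C1 b - B1 b"
    using order_tendstoD(1)[OF tendsto_diff[OF limC limB], of 0] assms pi_gt_zero by simp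
  moreover have "\<forall>\<^sub>F b in at_right 0. F < C1 b"
    using order_tendstoD(1)[OF limC, of F] assms by (simp add: F_def)
  moreover have "\<forall>\<^sub>F b in at_right 0. Arg (P b) < 1"
    using order_tendstoD(2)[OF limArg] by simp
  moreover have "\<forall>\<^sub>F b in at_right 0. 0 < cmod (P b)"
    by (rule order_tendstoD(1)[OF lim_cP \<open>0 < \<rho>\<close>])
  moreover have "\<forall>\<^sub>F b in at_right 0. 0 < (b::real)"
    by (rule eventually_at_right_less)
  ultimately have "\<forall>\<^sub>F b in at_right 0. 0 < b \<and> b < 1 \<and> 0 < A1 b \<and> 0 < A1 b - B1 b \<and>
      0 < C1 b - B1 b \<and> F < C1 b \<and> Arg (P b) < 1 \<and> 0 < cmod (P b) \<and> cmod (P b) \<le> \<rho>"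
    using small[of 1] ev\<rho> by (simp add: eventually_conj_iff)
  then obtain b where b: "0 < b" "b < 1" "0 < A1 b" "0 < A1 b - B1 b" "0 < C1 b - B1 b" "F < C1 b"
      "Arg (P b) < 1" "0 < cmod (P b)" "cmod (P b) \<le> \<rho>"
    using eventually_happens'[OF trivial_limit_at_right_real] by blast
  define m where "m = Arg (P b)"
  have Pm: "P b = of_real (cmod (P b)) * cis m"
    using rcis_cmod_Arg[of "P b"] by (simp add: m_def rcis_def)
  have "0 < sin (b / 2)"
    using b pi_gt3 by (intro sin_gt_zero) auto
  \<comment> \<open>Rotation by \<open>- b / 2\<close> reduces the comparison of
    \<open>Arg (P b)\<close> with \<open>b / 2\<close> to the sign of an imaginary part.\<close>
  have "P b * cis (- b / 2) = of_real \<rho> * cis (- b / 2) + (cis (b / 2 - \<mu>) - cis (- \<mu> - b / 2))"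
    by (simp add: P_def algebra_simps cis_mult)
  then have "Im (P b * cis (- b / 2)) =
      Im (of_real \<rho> * cis (- b / 2) + (cis (b / 2 - \<mu>) - cis (- \<mu> - b / 2)))"
    by (rule arg_cong)
  also have "\<dots> = sin (b / 2) * (2 * cos \<mu> - \<rho>)"
    by (simp add: sin_diff sin_add algebra_simps)
  also have "\<dots> < 0"
    using \<open>0 < sin (b / 2)\<close> \<open>2 * cos \<mu> < \<rho>\<close> by (simp add: mult_pos_neg)
  finally have "cmod (P b) * sin (m - b / 2) < 0"
    by (subst (asm) Pm) (simp add: sin_diff algebra_simps)
  then have "sin (m - b / 2) < 0"
    using b by (simp add: mult_less_0_iff)
  then have "2 * m < b"
    using b pi_gt3 sin_ge_zero[of "m - b / 2"] by (force simp: m_def)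
  have "cos (f b) = cmod (P b) / 2"
    using range[OF b(9)] by (auto simp: f_def)
  show ?thesis
  proof (rule shortenableI)
    let ?w' = "[(1, A1 b), (-1, A1 b - B1 b), (1, C1 b - B1 b), (-1, C1 b - F)]"
    show "word ?w'" using b by simp
    have "cis (A1 b) + cis (C1 b) = 2 * of_real (cos (f b)) * cis (M + m)"
      using cis_plus_cis[of "M + m" "f b"] by (simp add: A1_def C1_def m_def)
    also have "2 * of_real (cos (f b)) = complex_of_real (cmod (P b))"
      by (simp add: \<open>cos (f b) = _\<close>)
    also have "of_real (cmod (P b)) * cis (M + m) = of_real (cmod (P b)) * cis m * cis M"
      by (simp add: cis_mult add.commute mult.assoc)
    also have "of_real (cmod (P b)) * cis m = P b"
      by (simp only: Pm[symmetric])
    also have "P b * cis M = of_real \<rho> * cis M + cis (b - \<mu> + M) - cis (M - \<mu>)"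
      by (simp add: P_def algebra_simps cis_mult)
    also have "of_real \<rho> * cis M = cis l + cis (l - \<beta> + \<gamma>)"
    proof -
      have "M + n = l" "M - n = l - \<beta> + \<gamma>"
        by (simp_all add: M_def n_def field_simps)
      then show ?thesis
        using cis_plus_cis[of M n] by (simp add: \<rho>_def)
    qed
    also have "b - \<mu> + M = B1 b"
      by (simp add: B1_def B_def M_def \<mu>_def n_def field_simps)
    also have "M - \<mu> = l - \<beta>"
      by (simp add: M_def \<mu>_def n_def field_simps)
    finally have "cis (A1 b) + cis (C1 b) = cis l + cis (l - \<beta> + \<gamma>) + cis (B1 b) - cis (l - \<beta>)" .
    then have *: "cis (A1 b) = cis l + cis (l - \<beta> + \<gamma>) + cis (B1 b) - cis (l - \<beta>) - cis (C1 b)"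
      by (simp add: algebra_simps)
    show "word_disp 0 ?w' = word_disp 0 [(1, l), (-1, \<beta>), (1, \<gamma>), (-1, l')]"
      by (simp add: * right_diff_distrib distrib_left flip: F_def)
    show "word_turn ?w' = word_turn [(1, l), (-1, \<beta>), (1, \<gamma>), (-1, l')]"
      by (simp add: F_def)
    show "word_len ?w' < word_len [(1, l), (-1, \<beta>), (1, \<gamma>), (-1, l')]"
      using \<open>2 * m < b\<close> by (simp add: A1_def B1_def C1_def F_def M_def B_def n_def m_def field_simps)
  qed
qed

text \<open>A middle arc of at least a full circle contains a loop, and one of at most a half circle
  is flattened together with its two neighbours; only two middle arcs strictly in between
  remain.\<close>

lemma shortenable_CCCC:
  assumes "0 < l" "0 < \<beta>" "0 < \<gamma>" "0 < l'"
  shows "shortenable [(1, l), (-1, \<beta>), (1, \<gamma>), (-1, l')]"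
proof -
  consider "2 * pi \<le> \<beta>" | "2 * pi \<le> \<gamma>" | "\<beta> \<le> pi" | "\<gamma> \<le> pi"
    | "pi < \<beta>" "\<beta> < 2 * pi" "pi < \<gamma>" "\<gamma> < 2 * pi"
    by linarith
  then show ?thesis
  proof cases
    case 1
    then show ?thesis
      using shortenable_context[OF shortenable_loop[of \<beta> "-1"], of "[(1, l)]" "[(1, \<gamma>), (-1, l')]"] assms
      by simp
  next
    case 2
    then show ?thesis
      using shortenable_context[OF shortenable_loop[of \<gamma> 1], of "[(1, l), (-1, \<beta>)]" "[(-1, l')]"] assms
      by simp
  next
    case 3
    then show ?thesis
      using shortenable_context[OF shortenable_CCC[of l \<beta> \<gamma>], of "[]" "[(-1, l')]"] assms by simp
  next
    case 4
    have "shortenable (mirror [(-1, \<beta>), (1, \<gamma>), (-1, l')])"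
      using 4 shortenable_CCC[of \<beta> \<gamma> l'] assms by simp
    then show ?thesis
      using shortenable_context[OF shortenable_mirror, of "[(-1, \<beta>), (1, \<gamma>), (-1, l')]" "[(1, l)]" "[]"] assms
      by simp
  qed (use assms shortenable_CCCC_large in auto)
qed

text \<open>A segment in one of the first two places starts three consecutive pieces, in one of the
  last two it ends them. Its neighbour is an arc, so reflection and reversal lead to SCS or SCC.
  Without a segment the arcs alternate.\<close>

lemma shortenable_four_pieces:
  assumes "{k\<^sub>0, k\<^sub>1, k\<^sub>2, k\<^sub>3} \<subseteq> {1, -1, 0}" "k\<^sub>0 \<noteq> k\<^sub>1" "k\<^sub>1 \<noteq> k\<^sub>2" "k\<^sub>2 \<noteq> k\<^sub>3"
    and "0 < l\<^sub>0" "0 < l\<^sub>1" "0 < l\<^sub>2" "0 < l\<^sub>3"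
  shows "shortenable [(k\<^sub>0, l\<^sub>0), (k\<^sub>1, l\<^sub>1), (k\<^sub>2, l\<^sub>2), (k\<^sub>3, l\<^sub>3)]"
proof -
  have SCx: "shortenable [(0, s), (c, l), (c', m)]"
    if "c = 1 \<or> c = -1" "c' = 0 \<or> c' = - c" "0 < s" "0 < l" "0 < m" for c c' s l m
  proof -
    have "shortenable [(0, s), (1, l), (0, m)]" "shortenable [(0, s), (1, l), (-1, m)]"
      using shortenable_SCS shortenable_SCC that by auto
    then show ?thesis
      using shortenable_mirror[of "[(0, s), (-1, l), (0, m)]"]
        shortenable_mirror[of "[(0, s), (-1, l), (1, m)]"] that by auto
  qed
  have xCS: "shortenable [(c', m), (c, l), (0, s)]"
    if "c = 1 \<or> c = -1" "c' = 0 \<or> c' = - c" "0 < s" "0 < l" "0 < m" for c c' s l m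
    using SCx[of c c' s l m] shortenable_rev[of "[(c', m), (c, l), (0, s)]"] that by simp
  have CCCC: "shortenable [(c, l\<^sub>0), (- c, l\<^sub>1), (c, l\<^sub>2), (- c, l\<^sub>3)]" if "c = 1 \<or> c = -1" for c
    using that shortenable_CCCC[of l\<^sub>0 l\<^sub>1 l\<^sub>2 l\<^sub>3] assms(5-)
      shortenable_mirror[of "[(-1, l\<^sub>0), (1, l\<^sub>1), (-1, l\<^sub>2), (1, l\<^sub>3)]"] by auto
  have head: "shortenable [(k\<^sub>0, l\<^sub>0), (k\<^sub>1, l\<^sub>1), (k\<^sub>2, l\<^sub>2), (k\<^sub>3, l\<^sub>3)]"
    if "shortenable [(k\<^sub>0, l\<^sub>0), (k\<^sub>1, l\<^sub>1), (k\<^sub>2, l\<^sub>2)]"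
    using shortenable_context[OF that, of "[]" "[(k\<^sub>3, l\<^sub>3)]"] assms by auto
  have last: "shortenable [(k\<^sub>0, l\<^sub>0), (k\<^sub>1, l\<^sub>1), (k\<^sub>2, l\<^sub>2), (k\<^sub>3, l\<^sub>3)]"
    if "shortenable [(k\<^sub>1, l\<^sub>1), (k\<^sub>2, l\<^sub>2), (k\<^sub>3, l\<^sub>3)]"
    using shortenable_context[OF that, of "[(k\<^sub>0, l\<^sub>0)]" "[]"] assms by auto
  consider "k\<^sub>0 = 0" | "k\<^sub>1 = 0" | "k\<^sub>2 = 0" | "k\<^sub>3 = 0"
    | "k\<^sub>0 \<noteq> 0" "k\<^sub>1 = - k\<^sub>0" "k\<^sub>2 = k\<^sub>0" "k\<^sub>3 = - k\<^sub>0"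
    using assms by force
  then show ?thesis
  proof cases
    case 1
    then show ?thesis using SCx[of k\<^sub>1 k\<^sub>2 l\<^sub>0 l\<^sub>1 l\<^sub>2] assms by (intro head) force
  next
    case 2
    then show ?thesis using SCx[of k\<^sub>2 k\<^sub>3 l\<^sub>1 l\<^sub>2 l\<^sub>3] assms by (intro last) force
  next
    case 3
    then show ?thesis using xCS[of k\<^sub>1 k\<^sub>0 l\<^sub>2 l\<^sub>1 l\<^sub>0] assms by (intro head) force
  next
    case 4
    then show ?thesis using xCS[of k\<^sub>2 k\<^sub>1 l\<^sub>3 l\<^sub>2 l\<^sub>1] assms by (intro last) force
  next
    case 5
    then show ?thesis using CCCC[of k\<^sub>0] assms by auto
  qed
qed

section \<open>Trajectories\<close>

text \<open>
  In integral form, and with \<open>x + \<i> y\<close> as \<open>z\<close>, trajectories can be cut and glued. Only controls with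
  finitely many violations of the bound \<open>a\<close> occur, which avoids null sets.
\<close>

definition trajectory ::
  "real \<Rightarrow> (real \<Rightarrow> real) \<Rightarrow> (real \<Rightarrow> complex) \<Rightarrow> (real \<Rightarrow> real) \<Rightarrow> real \<Rightarrow> real \<Rightarrow> bool" where
  "trajectory a u z \<theta> c d \<longleftrightarrow>
     finite {s\<in>{c..d}. a < \<bar>u s\<bar>} \<and>
     (\<forall>s\<in>{c..d}. (u has_integral (\<theta> s - \<theta> c)) {c..s} \<and>
       ((\<lambda>r. cis (\<theta> r)) has_integral (z s - z c)) {c..s})"

lemma has_integral_cut_left:
  fixes f :: "real \<Rightarrow> 'a::banach"
  assumes "(f has_integral i) {a..c}" "(f has_integral j) {a..b}" "a \<le> c" "c \<le> b"
  shows "(f has_integral (j - i)) {c..b}"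
proof -
  have "f integrable_on {c..b}"
    using integrable_subinterval_real[OF has_integral_integrable[OF assms(2)]] assms(3) by simp
  then obtain k where k: "(f has_integral k) {c..b}"
    by (auto simp: integrable_on_def)
  then have "(f has_integral (i + k)) {a..b}"
    using assms has_integral_combine[of a c b f i k] by simp
  then have "j = i + k"
    by (rule has_integral_unique[OF assms(2)])
  then show ?thesis using k by simp
qed

lemma trajectory_cong:
  assumes "trajectory a u z \<theta> c d" "finite {s\<in>{c..d}. u' s \<noteq> u s}"
    and "\<And>s. s \<in> {c..d} \<Longrightarrow> z' s = z s" "\<And>s. s \<in> {c..d} \<Longrightarrow> \<theta>' s = \<theta> s"
  shows "trajectory a u' z' \<theta>' c d"
  unfolding trajectory_def
proof (intro conjI ballI)
  have "{s\<in>{c..d}. a < \<bar>u' s\<bar>} \<subseteq> {s\<in>{c..d}. a < \<bar>u s\<bar>} \<union> {s\<in>{c..d}. u' s \<noteq> u s}"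
    by auto
  then show "finite {s\<in>{c..d}. a < \<bar>u' s\<bar>}"
    using assms(1,2) finite_subset unfolding trajectory_def by blast
next
  fix s assume s: "s \<in> {c..d}"
  then have 1: "(u has_integral (\<theta> s - \<theta> c)) {c..s}"
    "((\<lambda>r. cis (\<theta> r)) has_integral (z s - z c)) {c..s}"
    using assms(1) unfolding trajectory_def by auto
  have eq: "z' s = z s" "z' c = z c" "\<theta>' s = \<theta> s" "\<theta>' c = \<theta> c"
    using s assms by auto
  show "(u' has_integral (\<theta>' s - \<theta>' c)) {c..s}"
    unfolding eq using assms(2) _ 1(1) by (rule has_integral_spike_finite) (use s in auto)
  show "((\<lambda>r. cis (\<theta>' r)) has_integral (z' s - z' c)) {c..s}"
    unfolding eq using _ 1(2) by (rule has_integral_eq) (use s assms in auto)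
qed

lemma trajectory_combine:
  assumes "trajectory a u z \<theta> c d" "trajectory a u z \<theta> d e" "c \<le> d" "d \<le> e"
  shows "trajectory a u z \<theta> c e"
  unfolding trajectory_def
proof (intro conjI ballI)
  have "{s\<in>{c..e}. a < \<bar>u s\<bar>} \<subseteq> {s\<in>{c..d}. a < \<bar>u s\<bar>} \<union> {s\<in>{d..e}. a < \<bar>u s\<bar>}"
    by auto
  then show "finite {s\<in>{c..e}. a < \<bar>u s\<bar>}"
    using assms(1,2) finite_subset unfolding trajectory_def by blast
next
  fix s assume s: "s \<in> {c..e}"
  have *: "(f has_integral (F s - F c)) {c..s}"
    if "\<forall>s\<in>{c..d}. (f has_integral (F s - F c)) {c..s}"
      "\<forall>s\<in>{d..e}. (f has_integral (F s - F d)) {d..s}"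
    for f F :: "real \<Rightarrow> 'b::banach"
  proof (cases "s \<le> d")
    case False
    then have "(f has_integral ((F d - F c) + (F s - F d))) {c..s}"
      using that s assms(3) by (intro has_integral_combine[of c d s]) auto
    then show ?thesis by simp
  qed (use that s in auto)
  show "(u has_integral (\<theta> s - \<theta> c)) {c..s}"
    using assms(1,2) unfolding trajectory_def by (intro *) auto
  show "((\<lambda>r. cis (\<theta> r)) has_integral (z s - z c)) {c..s}"
    using assms(1,2) unfolding trajectory_def by (intro *) auto
qed

lemma trajectory_glue:
  assumes "trajectory a u\<^sub>1 z\<^sub>1 \<theta>\<^sub>1 c d" "trajectory a u\<^sub>2 z\<^sub>2 \<theta>\<^sub>2 d e" "c \<le> d" "d \<le> e"
    and "z\<^sub>1 d = z\<^sub>2 d" "\<theta>\<^sub>1 d = \<theta>\<^sub>2 d"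
  shows "trajectory a (\<lambda>s. if s \<le> d then u\<^sub>1 s else u\<^sub>2 s) (\<lambda>s. if s \<le> d then z\<^sub>1 s else z\<^sub>2 s)
    (\<lambda>s. if s \<le> d then \<theta>\<^sub>1 s else \<theta>\<^sub>2 s) c e"
proof (rule trajectory_combine)
  show "trajectory a (\<lambda>s. if s \<le> d then u\<^sub>1 s else u\<^sub>2 s) (\<lambda>s. if s \<le> d then z\<^sub>1 s else z\<^sub>2 s)
    (\<lambda>s. if s \<le> d then \<theta>\<^sub>1 s else \<theta>\<^sub>2 s) c d"
    by (rule trajectory_cong[OF assms(1)]) auto
  have "{s\<in>{d..e}. (if s \<le> d then u\<^sub>1 s else u\<^sub>2 s) \<noteq> u\<^sub>2 s} \<subseteq> {d}"
    by auto
  then have "finite {s\<in>{d..e}. (if s \<le> d then u\<^sub>1 s else u\<^sub>2 s) \<noteq> u\<^sub>2 s}"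
    using finite_subset by blast
  then show "trajectory a (\<lambda>s. if s \<le> d then u\<^sub>1 s else u\<^sub>2 s) (\<lambda>s. if s \<le> d then z\<^sub>1 s else z\<^sub>2 s)
    (\<lambda>s. if s \<le> d then \<theta>\<^sub>1 s else \<theta>\<^sub>2 s) d e"
    by (rule trajectory_cong[OF assms(2)]) (use assms in auto)
qed (use assms in auto)

lemma trajectory_subinterval:
  assumes "trajectory a u z \<theta> c d" "c \<le> c'" "c' \<le> d'" "d' \<le> d"
  shows "trajectory a u z \<theta> c' d'"
  unfolding trajectory_def
proof (intro conjI ballI)
  have "{s\<in>{c'..d'}. a < \<bar>u s\<bar>} \<subseteq> {s\<in>{c..d}. a < \<bar>u s\<bar>}"
    using assms by auto
  then show "finite {s\<in>{c'..d'}. a < \<bar>u s\<bar>}"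
    using assms(1) finite_subset unfolding trajectory_def by blast
next
  fix s assume s: "s \<in> {c'..d'}"
  have *: "(f has_integral (F s - F c')) {c'..s}"
    if "\<forall>s\<in>{c..d}. (f has_integral (F s - F c)) {c..s}" for f F :: "real \<Rightarrow> 'b::banach"
    using has_integral_cut_left[of f "F c' - F c" c c' "F s - F c" s] that s assms by simp
  show "(u has_integral (\<theta> s - \<theta> c')) {c'..s}"
    using assms(1) unfolding trajectory_def by (intro *) auto
  show "((\<lambda>r. cis (\<theta> r)) has_integral (z s - z c')) {c'..s}"
    using assms(1) unfolding trajectory_def by (intro *) auto
qed

text \<open>Meant for the tail of a shortened path. The correction \<open>w\<close> is a multiple of
  \<open>2 * pi\<close>: a replacement preserves the turning only modulo \<open>2 * pi\<close>,
  whereas gluing requires equal real headings.\<close>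

lemma trajectory_shift:
  assumes "trajectory a u z \<theta> (c + h) (d + h)" "cis w = 1"
  shows "trajectory a (\<lambda>s. u (s + h)) (\<lambda>s. z (s + h)) (\<lambda>s. \<theta> (s + h) + w) c d"
  unfolding trajectory_def
proof (intro conjI ballI)
  have "{s\<in>{c..d}. a < \<bar>u (s + h)\<bar>} \<subseteq> (\<lambda>s. s - h) ` {s\<in>{c + h..d + h}. a < \<bar>u s\<bar>}"
    by (rule subsetI, rule_tac x = "x + h" in image_eqI) auto
  then show "finite {s\<in>{c..d}. a < \<bar>u (s + h)\<bar>}"
    using assms(1) finite_surj unfolding trajectory_def by blast
next
  fix s assume s: "s \<in> {c..d}"
  then have 1: "(u has_integral (\<theta> (s + h) - \<theta> (c + h))) {c + h..s + h}"
    "((\<lambda>r. cis (\<theta> r)) has_integral (z (s + h) - z (c + h))) {c + h..s + h}"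
    using assms(1) unfolding trajectory_def by auto
  show "((\<lambda>s. u (s + h)) has_integral (\<theta> (s + h) + w - (\<theta> (c + h) + w))) {c..s}"
    using has_integral_shift_real_ivl[OF 1(1), of h] by simp
  show "((\<lambda>s. cis (\<theta> (s + h) + w)) has_integral (z (s + h) - z (c + h))) {c..s}"
    using has_integral_shift_real_ivl[OF 1(2), of h] assms(2) by (simp flip: cis_mult)
qed

section \<open>Trajectories that follow a word\<close>

lemma has_integral_arc:
  assumes "0 < a" "k \<in> {1, -1, 0}" "c \<le> s"
  shows "((\<lambda>r. cis (\<phi> + a * k * (r - c))) has_integral (word_disp \<phi> [(k, a * (s - c))] / a)) {c..s}"
proof (cases "k = 0")
  case True
  then show ?thesis
    using has_integral_const_real[of "cis \<phi>" c s] assms by (simp add: scaleR_conv_of_real)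
next
  case False
  let ?F = "\<lambda>r. - \<i> * k * cis (\<phi> + a * k * (r - c)) / a"
  have k: "complex_of_real k * complex_of_real k = 1"
    using False assms by auto
  have "((\<lambda>r. cis (\<phi> + a * k * (r - c))) has_integral (?F s - ?F c)) {c..s}"
  proof (rule fundamental_theorem_of_calculus)
    fix r
    have "((\<lambda>r. cis (\<phi> + a * k * (r - c))) has_vector_derivative
        (a * k) *\<^sub>R (\<i> * cis (\<phi> + a * k * (r - c)))) (at r within {c..s})"
      unfolding has_vector_derivative_def
      by (rule derivative_eq_intros refl | simp add: scaleR_conv_of_real mult_ac)+
    then have "((\<lambda>r. (- \<i> * k / a) * cis (\<phi> + a * k * (r - c))) has_vector_derivative
        (- \<i> * k / a) * ((a * k) *\<^sub>R (\<i> * cis (\<phi> + a * k * (r - c))))) (at r within {c..s})"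
      by (rule has_vector_derivative_mult_right)
    moreover have "(- \<i> * k / a) * ((a * k) *\<^sub>R (\<i> * cis (\<phi> + a * k * (r - c))))
        = (of_real k * of_real k) * cis (\<phi> + a * k * (r - c))"
      using assms by (simp add: complex_eq_iff)
    ultimately show "(?F has_vector_derivative cis (\<phi> + a * k * (r - c))) (at r within {c..s})"
      unfolding k by simp
  qed (use assms in simp)
  moreover have "?F s - ?F c = word_disp \<phi> [(k, a * (s - c))] / a"
    using False by (simp add: algebra_simps diff_divide_distrib)
  ultimately show ?thesis by simp
qed

lemma trajectory_arc:
  assumes "0 < a" "k \<in> {1, -1, 0}"
  shows "trajectory a (\<lambda>s. a * k) (\<lambda>s. w + word_disp \<phi> [(k, a * (s - c))] / a)
    (\<lambda>s. \<phi> + a * k * (s - c)) c d"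
  unfolding trajectory_def
proof (intro conjI ballI)
  have "\<not> a < \<bar>a * k\<bar>"
    using assms by (auto simp: abs_mult)
  then show "finite {s\<in>{c..d}. a < \<bar>a * k\<bar>}"
    by simp
next
  fix s assume s: "s \<in> {c..d}"
  show "((\<lambda>s. a * k) has_integral (\<phi> + a * k * (s - c) - (\<phi> + a * k * (c - c)))) {c..s}"
    using has_integral_const_real[of "a * k" c s] s by (simp add: mult.commute)
  have zero: "word_disp \<phi> [(k, 0)] = 0"
    by simp
  show "((\<lambda>r. cis (\<phi> + a * k * (r - c))) has_integral (w + word_disp \<phi> [(k, a * (s - c))] / a -
      (w + word_disp \<phi> [(k, a * (c - c))] / a))) {c..s}"
    using has_integral_arc[OF assms, of c s \<phi>] s by (simp add: zero del: word_disp.simps)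
qed

lemma word_trajectory_exists:
  assumes "0 < a" "word w"
  shows "\<exists>u z \<theta>. trajectory a u z \<theta> c (c + word_len w / a) \<and> z c = q \<and> \<theta> c = \<phi> \<and>
    z (c + word_len w / a) = q + word_disp \<phi> w / a \<and> \<theta> (c + word_len w / a) = \<phi> + word_turn w"
  using assms(2)
proof (induction w arbitrary: c q \<phi>)
  case Nil
  show ?case
    using trajectory_arc[OF assms(1), of 0 q \<phi> c c]
    by (intro exI[of _ "\<lambda>_. 0"] exI[of _ "\<lambda>s. q + word_disp \<phi> [(0, a * (s - c))] / a"] exI[of _ "\<lambda>_. \<phi>"]) auto
next
  case (Cons x w)
  obtain k l where x: "x = (k, l)" by force
  have k: "k \<in> {1, -1, 0}" and l: "0 \<le> l" and w: "word w"
    using Cons.prems by (auto simp: x)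
  define e where "e = c + l / a"
  let ?z1 = "\<lambda>s. q + word_disp \<phi> [(k, a * (s - c))] / a" and ?\<theta>1 = "\<lambda>s. \<phi> + a * k * (s - c)"
  have e: "a * (e - c) = l" "c \<le> e"
    using assms(1) l by (auto simp: e_def)
  have \<theta>1e: "?\<theta>1 e = \<phi> + k * l" using e by (metis mult.assoc mult.commute)
  obtain u z \<theta> where IH: "trajectory a u z \<theta> e (e + word_len w / a)"
    "z e = ?z1 e" "\<theta> e = \<phi> + k * l"
    "z (e + word_len w / a) = ?z1 e + word_disp (\<phi> + k * l) w / a"
    "\<theta> (e + word_len w / a) = \<phi> + k * l + word_turn w"
    using Cons.IH[OF w, of e "?z1 e" "\<phi> + k * l"] by blast
  have end_eq: "c + word_len (x # w) / a = e + word_len w / a"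
    by (simp add: x e_def add_divide_distrib)
  have le: "e \<le> e + word_len w / a"
    using word_len_nonneg[OF w] assms(1) by simp
  have tr: "trajectory a (\<lambda>s. if s \<le> e then a * k else u s) (\<lambda>s. if s \<le> e then ?z1 s else z s)
      (\<lambda>s. if s \<le> e then ?\<theta>1 s else \<theta> s) c (e + word_len w / a)"
    by (rule trajectory_glue[OF trajectory_arc[OF assms(1) k] IH(1)]) (use e le IH \<theta>1e in auto)
  have "?z1 e + word_disp (\<phi> + k * l) w / a = q + word_disp \<phi> (x # w) / a"
    unfolding e by (simp add: x add_divide_distrib)
  then have zq: "z (e + word_len w / a) = q + word_disp \<phi> (x # w) / a"
    unfolding IH .
  \<comment> \<open>If the rest of the word has length zero, the final time is the junction
    \<open>e\<close> itself, where the glued functions take the first branch; both branches agree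
    there.\<close>
  have eq: "?z1 (e + word_len w / a) = z (e + word_len w / a)"
    "?\<theta>1 (e + word_len w / a) = \<theta> (e + word_len w / a)" if "e + word_len w / a \<le> e"
  proof -
    have "e + word_len w / a = e"
      using le that by simp
    then show "?z1 (e + word_len w / a) = z (e + word_len w / a)"
      "?\<theta>1 (e + word_len w / a) = \<theta> (e + word_len w / a)"
      using IH(2,3) \<theta>1e by metis+
  qed
  have zend: "(if e + word_len w / a \<le> e then ?z1 (e + word_len w / a) else z (e + word_len w / a))
      = q + word_disp \<phi> (x # w) / a"
    using eq(1) zq by presburger
  have \<theta>end: "(if e + word_len w / a \<le> e then ?\<theta>1 (e + word_len w / a) else \<theta> (e + word_len w / a))
      = \<phi> + word_turn (x # w)"
    using eq(2) IH(5) by (simp add: x)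
  show ?case
    unfolding end_eq
    by (intro exI[of _ "\<lambda>s. if s \<le> e then a * k else u s"] exI[of _ "\<lambda>s. if s \<le> e then ?z1 s else z s"]
        exI[of _ "\<lambda>s. if s \<le> e then ?\<theta>1 s else \<theta> s"] conjI tr zend \<theta>end) (use e in auto)
qed

text \<open>Finitely many exceptions are allowed because the values of the control at breakpoints
  are arbitrary.\<close>

fun follows :: "real \<Rightarrow> (real \<Rightarrow> real) \<Rightarrow> real \<Rightarrow> (real \<times> real) list \<Rightarrow> bool" where
  "follows a u c [] \<longleftrightarrow> True"
| "follows a u c ((k, l) # w) \<longleftrightarrow>
     finite {s\<in>{c..c + l / a}. u s \<noteq> a * k} \<and> follows a u (c + l / a) w"

text \<open>The control determines the heading by integration and the heading determines the
  displacement, so the end configuration of a given path can be read off its word.\<close>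

lemma trajectory_follows:
  assumes "0 < a" "word w" "follows a u c w" "trajectory a u z \<theta> c (c + word_len w / a)"
  shows "z (c + word_len w / a) = z c + word_disp (\<theta> c) w / a"
    and "\<theta> (c + word_len w / a) = \<theta> c + word_turn w"
proof -
  have "z (c + word_len w / a) = z c + word_disp (\<theta> c) w / a \<and>
    \<theta> (c + word_len w / a) = \<theta> c + word_turn w"
    using assms(2-)
  proof (induction w arbitrary: c)
    case (Cons x w)
    obtain k l where x: "x = (k, l)" by force
    have k: "k \<in> {1, -1, 0}" and l: "0 \<le> l" and w: "word w"
      using Cons.prems by (auto simp: x)
    define e where "e = c + l / a"
    have e: "a * (e - c) = l" "c \<le> e"
      using assms(1) l by (auto simp: e_def)
    have end_eq: "c + word_len (x # w) / a = e + word_len w / a"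
      by (simp add: x e_def add_divide_distrib)
    have le: "e \<le> e + word_len w / a"
      using word_len_nonneg[OF w] assms(1) by simp
    note tr = Cons.prems(3)[unfolded end_eq]
    have tr1: "trajectory a u z \<theta> c e" and tr2: "trajectory a u z \<theta> e (e + word_len w / a)"
      by (rule trajectory_subinterval[OF tr]; use e le in auto)+
    have fin: "finite {s\<in>{c..e}. u s \<noteq> a * k}" and "follows a u e w"
      using Cons.prems(2) by (auto simp: x e_def)
    then have IH: "z (e + word_len w / a) = z e + word_disp (\<theta> e) w / a"
      "\<theta> (e + word_len w / a) = \<theta> e + word_turn w"
      using Cons.IH[of e] w tr2 by auto
    have \<theta>: "\<theta> s = \<theta> c + a * k * (s - c)" if s: "s \<in> {c..e}" for s
    proof -
      have "(u has_integral (\<theta> s - \<theta> c)) {c..s}"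
        using tr1 s unfolding trajectory_def by auto
      moreover have "((\<lambda>_. a * k) has_integral (s - c) * (a * k)) {c..s}"
        using has_integral_const_real[of "a * k" c s] s by simp
      then have "(u has_integral (s - c) * (a * k)) {c..s}"
        by (rule has_integral_spike_finite[OF fin, rotated]) (use s in auto)
      ultimately have "\<theta> s - \<theta> c = (s - c) * (a * k)"
        by (rule has_integral_unique)
      then show ?thesis by (simp add: algebra_simps)
    qed
    have arc: "((\<lambda>r. cis (\<theta> c + a * k * (r - c))) has_integral
        (word_disp (\<theta> c) [(k, l)] / a)) {c..e}"
      using has_integral_arc[OF assms(1) k \<open>c \<le> e\<close>, of "\<theta> c"] unfolding e(1) .
    have "((\<lambda>r. cis (\<theta> r)) has_integral (word_disp (\<theta> c) [(k, l)] / a)) {c..e}"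
    proof (rule has_integral_eq[OF _ arc])
      fix r assume "r \<in> {c..e}"
      from \<theta>[OF this] show "cis (\<theta> c + a * k * (r - c)) = cis (\<theta> r)" by simp
    qed
    moreover have "((\<lambda>r. cis (\<theta> r)) has_integral (z e - z c)) {c..e}"
      using tr1 e unfolding trajectory_def by auto
    ultimately have "z e - z c = word_disp (\<theta> c) [(k, l)] / a"
      using has_integral_unique by blast
    then have "z e = z c + word_disp (\<theta> c) [(k, l)] / a"
      by (simp add: algebra_simps)
    moreover have "\<theta> e = \<theta> c + k * l"
    proof -
      have "a * k * (e - c) = k * (a * (e - c))" by simp
      then show ?thesis using \<theta>[of e] e by simp
    qed
    ultimately show ?case
      unfolding end_eq using IH by (simp add: x add_divide_distrib)
  qed simp
  then show "z (c + word_len w / a) = z c + word_disp (\<theta> c) w / a"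
    "\<theta> (c + word_len w / a) = \<theta> c + word_turn w" by auto
qed

lemma partition_cover:
  fixes \<tau> :: "nat \<Rightarrow> real"
  assumes "\<forall>j<n. \<tau> j < \<tau> (Suc j)" "\<tau> 0 \<le> s" "s \<le> \<tau> n"
  shows "s \<in> \<tau> ` {..n} \<or> (\<exists>j<n. s \<in> {\<tau> j<..<\<tau> (Suc j)})"
  using assms
proof (induction n)
  case (Suc n)
  show ?case
  proof (cases "s \<le> \<tau> n")
    case True
    then have "s \<in> \<tau> ` {..n} \<or> (\<exists>j<n. s \<in> {\<tau> j<..<\<tau> (Suc j)})"
      using Suc by simp
    then show ?thesis
      using less_SucI by (metis atMost_Suc image_insert insertCI)
  next
    case False
    then have "s = \<tau> (Suc n) \<or> s \<in> {\<tau> n<..<\<tau> (Suc n)}"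
      using Suc.prems by auto
    then show ?thesis by blast
  qed
qed auto

text \<open>Every time in this set is a breakpoint. Describing it by local constancy hides the
  chosen partition and captures arbitrary values at breakpoints and switches alike.\<close>

lemma finite_not_locally_constant:
  assumes "piecewise_constant_control a T u"
  shows "finite {s\<in>{0..T}. \<not> (u s \<in> {a, - a, 0} \<and> (\<forall>\<^sub>F r in nhds s. u r = u s))}" (is "finite ?F")
proof -
  obtain n \<tau> where \<tau>: "\<tau> 0 = 0" "\<tau> n = T" "\<forall>j<n. \<tau> j < \<tau> (Suc j)"
    "\<forall>j<n. \<exists>k\<in>{a, -a, 0}. \<forall>s\<in>{\<tau> j<..<\<tau> (Suc j)}. u s = k"
    using assms unfolding piecewise_constant_control_def by blast
  have "?F \<subseteq> \<tau> ` {..n}"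
  proof
    fix s assume "s \<in> ?F"
    then have s: "0 \<le> s" "s \<le> T"
      and nc: "\<not> (u s \<in> {a, - a, 0} \<and> (\<forall>\<^sub>F r in nhds s. u r = u s))"
      unfolding mem_Collect_eq atLeastAtMost_iff by blast+
    have "s \<in> \<tau> ` {..n} \<or> (\<exists>j<n. s \<in> {\<tau> j<..<\<tau> (Suc j)})"
      by (rule partition_cover[OF \<tau>(3)]; use s \<tau>(1,2) in simp)
    moreover have "s \<notin> {\<tau> j<..<\<tau> (Suc j)}" if j: "j < n" for j
    proof
      assume sj: "s \<in> {\<tau> j<..<\<tau> (Suc j)}"
      obtain k where k: "k \<in> {a, - a, 0}" "\<forall>s\<in>{\<tau> j<..<\<tau> (Suc j)}. u s = k"
        using \<tau>(4)[rule_format, OF j] by blast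
      have "\<forall>\<^sub>F r in nhds s. r \<in> {\<tau> j<..<\<tau> (Suc j)}"
        using sj by (intro eventually_nhds_in_open) auto
      then have "\<forall>\<^sub>F r in nhds s. u r = u s"
        by eventually_elim (use k sj in auto)
      moreover have "u s \<in> {a, - a, 0}"
        using k sj by blast
      ultimately show False
        using nc by blast
    qed
    ultimately show "s \<in> \<tau> ` {..n}"
      by blast
  qed
  then show ?thesis
    using finite_subset by blast
qed

section \<open>Between feasible paths and trajectories\<close>

lemma feasible_trajectory:
  assumes "feasible N a p \<theta>\<^sub>0 \<theta>\<^sub>f t u x y \<theta>" "piecewise_constant_control a (t N) u" "0 < a"
  shows "trajectory a u (\<lambda>s. Complex (x s) (y s)) \<theta> 0 (t N)"
  unfolding trajectory_def
proof (intro conjI ballI)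
  have "u s \<notin> {a, - a, 0}" if "a < \<bar>u s\<bar>" for s
    using that assms(3) by auto
  then have "{s\<in>{0..t N}. a < \<bar>u s\<bar>} \<subseteq>
      {s\<in>{0..t N}. \<not> (u s \<in> {a, - a, 0} \<and> (\<forall>\<^sub>F r in nhds s. u r = u s))}"
    by blast
  then show "finite {s\<in>{0..t N}. a < \<bar>u s\<bar>}"
    using finite_not_locally_constant[OF assms(2)] by (rule finite_subset)
next
  fix s assume s: "s \<in> {0..t N}"
  show "(u has_integral (\<theta> s - \<theta> 0)) {0..s}"
    using assms(1) s unfolding feasible_def by blast
  show "((\<lambda>r. cis (\<theta> r)) has_integral (Complex (x s) (y s) - Complex (x 0) (y 0))) {0..s}"
  proof (rule fundamental_theorem_of_calculus)
    fix r assume r: "r \<in> {0..s}"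
    then have "(x has_real_derivative cos (\<theta> r)) (at r within {0..t N})"
      "(y has_real_derivative sin (\<theta> r)) (at r within {0..t N})"
      using assms(1) s unfolding feasible_def by simp_all
    then have "(x has_real_derivative cos (\<theta> r)) (at r within {0..s}) \<and>
      (y has_real_derivative sin (\<theta> r)) (at r within {0..s})"
      using has_field_derivative_subset[of _ _ r "{0..t N}" "{0..s}"] s by simp
    then show "((\<lambda>s. Complex (x s) (y s)) has_vector_derivative cis (\<theta> r)) (at r within {0..s})"
      unfolding has_vector_derivative_complex_iff by simp
  qed (use s in simp)
qed

lemma trajectory_feasible:
  assumes "trajectory a u z \<theta> 0 (t N)" "t 0 = 0" "\<forall>i\<in>{1..N}. t (i - 1) < t i" "0 \<le> t N"
    and "\<forall>i\<le>N. (Re (z (t i)), Im (z (t i))) = p i"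
    and "[\<theta> 0 = \<theta>\<^sub>0] (rmod (2 * pi))" "[\<theta> (t N) = \<theta>\<^sub>f] (rmod (2 * pi))"
  shows "feasible N a p \<theta>\<^sub>0 \<theta>\<^sub>f t u (\<lambda>s. Re (z s)) (\<lambda>s. Im (z s)) \<theta>"
proof -
  have u: "\<forall>s\<in>{0..t N}. (u has_integral (\<theta> s - \<theta> 0)) {0..s}"
    and z: "\<forall>s\<in>{0..t N}. ((\<lambda>r. cis (\<theta> r)) has_integral (z s - z 0)) {0..s}"
    and fin: "finite {s\<in>{0..t N}. a < \<bar>u s\<bar>}"
    using assms(1) unfolding trajectory_def by auto
  have int: "u integrable_on {0..t N}"
    using u assms(4) by (auto simp: integrable_on_def)
  have "{s\<in>{0..t N}. a < \<bar>u s\<bar>} \<in> null_sets (lebesgue_on {0..t N})"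
    using fin by (subst null_sets_restrict_space) (auto simp: negligible_finite simp flip: negligible_iff_null_sets)
  from AE_not_in[OF this] have ae: "AE s in lebesgue_on {0..t N}. \<bar>u s\<bar> \<le> a"
    using AE_space[of "lebesgue_on {0..t N}"] by eventually_elim auto
  \<comment> \<open>As an indefinite integral \<open>\<theta>\<close> is continuous, so the integral
    equation for \<open>z\<close> can be differentiated at every time.\<close>
  have "continuous_on {0..t N} (\<lambda>s. \<theta> 0 + integral {0..s} u)"
    using indefinite_integral_continuous_1[OF int] by (intro continuous_intros)
  moreover have "\<theta> 0 + integral {0..s} u = \<theta> s" if "s \<in> {0..t N}" for s
    using integral_unique[of u "\<theta> s - \<theta> 0" "{0..s}"] u that by simp
  ultimately have "continuous_on {0..t N} \<theta>"
    using continuous_on_cong[of "{0..t N}" "{0..t N}" "\<lambda>s. \<theta> 0 + integral {0..s} u" \<theta>] by simp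
  then have cont: "continuous_on {0..t N} (\<lambda>s. cis (\<theta> s))"
    by (intro continuous_intros)
  have dz: "(z has_vector_derivative cis (\<theta> s)) (at s within {0..t N})" if s: "s \<in> {0..t N}" for s
  proof -
    have "((\<lambda>s. z 0 + integral {0..s} (\<lambda>r. cis (\<theta> r))) has_vector_derivative 0 + cis (\<theta> s)) (at s within {0..t N})"
      using integral_has_vector_derivative[OF cont s]
      by (intro has_vector_derivative_add has_vector_derivative_const)
    then have *: "((\<lambda>s. z 0 + integral {0..s} (\<lambda>r. cis (\<theta> r))) has_vector_derivative cis (\<theta> s)) (at s within {0..t N})"
      by simp
    show ?thesis
    proof (rule has_vector_derivative_transform[OF s _ *])
      fix r assume "r \<in> {0..t N}"
      then show "z r = z 0 + integral {0..r} (\<lambda>r. cis (\<theta> r))"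
        using integral_unique[of "\<lambda>r. cis (\<theta> r)" "z r - z 0" "{0..r}"] z by simp
    qed
  qed
  have "\<forall>s\<in>{0..t N}. ((\<lambda>s. Re (z s)) has_real_derivative cos (\<theta> s)) (at s within {0..t N})"
    "\<forall>s\<in>{0..t N}. ((\<lambda>s. Im (z s)) has_real_derivative sin (\<theta> s)) (at s within {0..t N})"
    using dz unfolding has_vector_derivative_complex_iff by simp_all
  then show ?thesis
    unfolding feasible_def
    by (intro conjI assms u ae integrable_imp_measurable[OF int])
qed

lemma nodes_mono:
  fixes t :: "nat \<Rightarrow> real"
  assumes "\<forall>i\<in>{1..N}. t (i - 1) < t i" "j \<le> k" "k \<le> N"
  shows "t j \<le> t k"
  using assms(2,3)
proof (induction k)
  case (Suc k)
  have "t k < t (Suc k)"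
    using assms(1) Suc.prems by force
  with Suc show ?case by (cases "j = Suc k") auto
qed simp

text \<open>A shorter word \<open>w'\<close> is spliced in at time \<open>c\<close>, and the rest of
  the path and the node times from \<open>t i\<close> on are moved earlier by the saved time
  \<open>h\<close>. The result is feasible and reaches the last node sooner.\<close>

lemma optimal_not_shortenable:
  assumes "0 < a" and neq: "\<forall>i\<in>{1..N}. p (i - 1) \<noteq> p i"
    and opt: "optimal N a p \<theta>\<^sub>0 \<theta>\<^sub>f t u x y \<theta>" and pcc: "piecewise_constant_control a (t N) u"
    and i: "i \<in> {1..N}" and c: "t (i - 1) \<le> c" and d: "c + word_len w / a \<le> t i"
    and w: "word w" "follows a u c w"
  shows "\<not> shortenable w"
proof
  assume "shortenable w"
  then obtain w' where w': "word w'" "cis (word_turn w') = cis (word_turn w)"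
    "word_disp 0 w' = word_disp 0 w" "word_len w' < word_len w"
    unfolding shortenable_def by blast
  have feas: "feasible N a p \<theta>\<^sub>0 \<theta>\<^sub>f t u x y \<theta>"
    using opt unfolding optimal_def by blast
  define z where "z = (\<lambda>s. Complex (x s) (y s))"
  have tr: "trajectory a u z \<theta> 0 (t N)"
    using feasible_trajectory[OF feas pcc \<open>0 < a\<close>] by (simp add: z_def)
  have t0: "t 0 = 0" and incr: "\<forall>i\<in>{1..N}. t (i - 1) < t i"
    and nodes: "\<forall>i\<le>N. (x (t i), y (t i)) = p i"
    and ends: "[\<theta> 0 = \<theta>\<^sub>0] (rmod (2 * pi))" "[\<theta> (t N) = \<theta>\<^sub>f] (rmod (2 * pi))"
    using feas unfolding feasible_def by blast+
  note mono = nodes_mono[OF incr]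
  define d e where "d = c + word_len w / a" and "e = c + word_len w' / a"
  define h where "h = d - e"
  have "0 < h"
    using w'(4) \<open>0 < a\<close> by (simp add: h_def d_def e_def divide_strict_right_mono)
  have "0 \<le> c"
    using mono[of 0 "i - 1"] t0 c i by (simp add: le_diff_conv)
  have "c \<le> e" "e < d"
    using word_len_nonneg[OF w'(1)] \<open>0 < a\<close> \<open>0 < h\<close> by (auto simp: h_def e_def)
  have "d \<le> t N"
    using mono[of i N] i d by (auto simp: d_def)
  have "trajectory a u z \<theta> c d"
    using trajectory_subinterval[OF tr] \<open>0 \<le> c\<close> \<open>c \<le> e\<close> \<open>e < d\<close> \<open>d \<le> t N\<close> by simp
  then have zd: "z d = z c + word_disp (\<theta> c) w / a" and \<theta>d: "\<theta> d = \<theta> c + word_turn w"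
    using trajectory_follows[OF \<open>0 < a\<close> w, of z \<theta>] by (simp_all add: d_def)
  obtain v q \<phi> where v: "trajectory a v q \<phi> c e" "q c = z c" "\<phi> c = \<theta> c"
    "q e = z c + word_disp (\<theta> c) w' / a" "\<phi> e = \<theta> c + word_turn w'"
    using word_trajectory_exists[OF \<open>0 < a\<close> w'(1), of c "z c" "\<theta> c"] unfolding e_def by blast
  have qe: "q e = z (e + h)"
    using v(4) zd w'(3) word_disp_eq[of "\<theta> c" w] word_disp_eq[of "\<theta> c" w'] by (simp add: h_def)
  define \<omega> where "\<omega> = word_turn w' - word_turn w"
  have "cis \<omega> = 1"
    using w'(2) by (simp add: \<omega>_def flip: cis_divide)
  then obtain n where n: "\<omega> = of_int n * (2 * pi)"
    using cis_eq_1_iff by blast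
  have \<phi>e: "\<phi> e = \<theta> (e + h) + \<omega>"
    using v(5) \<theta>d by (simp add: \<omega>_def h_def)
  have tr3: "trajectory a (\<lambda>s. u (s + h)) (\<lambda>s. z (s + h)) (\<lambda>s. \<theta> (s + h) + \<omega>) e (t N - h)"
  proof (rule trajectory_shift)
    show "trajectory a u z \<theta> (e + h) (t N - h + h)"
      using trajectory_subinterval[OF tr, of d "t N"] \<open>0 \<le> c\<close> \<open>c \<le> e\<close> \<open>e < d\<close> \<open>d \<le> t N\<close>
      by (simp add: h_def)
  qed fact
  define u\<^sub>1 z\<^sub>1 \<theta>\<^sub>1 where "u\<^sub>1 = (\<lambda>s. if s \<le> c then u s else v s)"
    and "z\<^sub>1 = (\<lambda>s. if s \<le> c then z s else q s)" and "\<theta>\<^sub>1 = (\<lambda>s. if s \<le> c then \<theta> s else \<phi> s)"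
  have tr1: "trajectory a u\<^sub>1 z\<^sub>1 \<theta>\<^sub>1 0 e"
    unfolding u\<^sub>1_def z\<^sub>1_def \<theta>\<^sub>1_def
    by (rule trajectory_glue[OF trajectory_subinterval[OF tr] v(1)])
      (use \<open>0 \<le> c\<close> \<open>c \<le> e\<close> \<open>e < d\<close> \<open>d \<le> t N\<close> v in auto)
  have z1e: "z\<^sub>1 e = z (e + h)" and \<theta>1e: "\<theta>\<^sub>1 e = \<theta> (e + h) + \<omega>"
    using \<open>c \<le> e\<close> v(2,3) qe \<phi>e by (auto simp: z\<^sub>1_def \<theta>\<^sub>1_def)
  define U Z \<Theta> where "U = (\<lambda>s. if s \<le> e then u\<^sub>1 s else u (s + h))"
    and "Z = (\<lambda>s. if s \<le> e then z\<^sub>1 s else z (s + h))"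
    and "\<Theta> = (\<lambda>s. if s \<le> e then \<theta>\<^sub>1 s else \<theta> (s + h) + \<omega>)"
  have TR: "trajectory a U Z \<Theta> 0 (t N - h)"
    unfolding U_def Z_def \<Theta>_def
    by (rule trajectory_glue[OF tr1 tr3])
      (use \<open>0 \<le> c\<close> \<open>c \<le> e\<close> \<open>d \<le> t N\<close> z1e \<theta>1e in \<open>auto simp: h_def\<close>)
  have ZL: "Z s = z s" "\<Theta> s = \<theta> s" if "s \<le> c" for s
    using that \<open>c \<le> e\<close> by (auto simp: Z_def z\<^sub>1_def \<Theta>_def \<theta>\<^sub>1_def)
  have ZR: "Z s = z (s + h)" "\<Theta> s = \<theta> (s + h) + \<omega>" if "e \<le> s" for s
    using that z1e \<theta>1e by (cases "s = e"; simp add: Z_def \<Theta>_def)+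
  define t' where "t' = (\<lambda>j. if j < i then t j else t j - h)"
  have left: "t j \<le> c" if "j < i" for j
  proof -
    have "j \<le> i - 1" "i - 1 \<le> N" using that i by auto
    with mono[of j "i - 1"] c show ?thesis by simp
  qed
  have right: "e \<le> t j - h" if "i \<le> j" "j \<le> N" for j
    using mono[of i j] that d by (simp add: h_def d_def)
  have Zt: "Z (t' j) = z (t j)" if "j \<le> N" for j
    using that ZL(1)[of "t j"] ZR(1)[of "t j - h"] left[of j] right[of j] by (simp add: t'_def)
  have t'N: "t' N = t N - h"
    using i by (simp add: t'_def)
  have "feasible N a p \<theta>\<^sub>0 \<theta>\<^sub>f t' U (\<lambda>s. Re (Z s)) (\<lambda>s. Im (Z s)) \<Theta>"
  proof (rule trajectory_feasible)
    show "trajectory a U Z \<Theta> 0 (t' N)"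
      using TR t'N by simp
    show "t' 0 = 0"
      using i t0 by (simp add: t'_def)
    show "0 \<le> t' N"
      using right[of N] i \<open>0 \<le> c\<close> \<open>c \<le> e\<close> unfolding t'N by simp
    show "\<forall>j\<in>{1..N}. t' (j - 1) < t' j"
    proof
      fix j assume j: "j \<in> {1..N}"
      consider "j < i" | "j = i" | "i < j" by linarith
      then show "t' (j - 1) < t' j"
      proof cases
        case 2
        have "t' (i - 1) \<le> c" "e \<le> t' i"
          using left[of "i - 1"] right[of i] i by (auto simp: t'_def)
        \<comment> \<open>The times satisfy only
          \<open>t' (i - 1) \<le> c \<le> e \<le> t' i\<close>. Equality throughout would put two
          consecutive nodes at the same point.\<close>
        moreover have "t' (i - 1) \<noteq> t' i"
        proof
          assume "t' (i - 1) = t' i"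
          then have "z (t (i - 1)) = z (t i)"
            using Zt[of "i - 1"] Zt[of i] i by simp
          then have "p (i - 1) = p i"
            using nodes[rule_format, of "i - 1"] nodes[rule_format, of i] i by (auto simp: z_def)
          then show False using neq i by blast
        qed
        ultimately show ?thesis using 2 \<open>c \<le> e\<close> by simp
      qed (use incr j in \<open>auto simp: t'_def\<close>)
    qed
    show "\<forall>j\<le>N. (Re (Z (t' j)), Im (Z (t' j))) = p j"
      using Zt nodes by (simp add: z_def)
    show "[\<Theta> 0 = \<theta>\<^sub>0] (rmod (2 * pi))"
      using ZL(2)[of 0] \<open>0 \<le> c\<close> ends(1) by simp
    have "\<Theta> (t' N) = \<theta> (t N) + of_int n * (2 * pi)"
      using ZR(2)[of "t N - h"] right[of N] i unfolding t'N n by simp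
    moreover have "[\<theta> (t N) = \<theta> (t N) + of_int n * (2 * pi)] (rmod (2 * pi))"
      unfolding rcong_altdef by blast
    ultimately show "[\<Theta> (t' N) = \<theta>\<^sub>f] (rmod (2 * pi))"
      using ends(2) by (metis rcong_sym rcong_trans)
  qed
  then have "t N \<le> t' N"
    using opt unfolding optimal_def by blast
  then show False
    using \<open>0 < h\<close> t'N by simp
qed

section \<open>Counting switches and maximal pieces\<close>

text \<open>One-sided limits ignore the arbitrary values at breakpoints; the times 0 and
  \<open>T\<close> are left out because the path lies on one side of them only.\<close>

definition switches :: "real \<Rightarrow> (real \<Rightarrow> real) \<Rightarrow> real set" where
  "switches T u = {s\<in>{0<..<T}. Lim (at_left s) u \<noteq> Lim (at_right s) u}"

lemma Lim_eventually:
  fixes f :: "'a \<Rightarrow> 'b::t2_space"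
  assumes "\<forall>\<^sub>F x in F. f x = l" "F \<noteq> bot"
  shows "Lim F f = l"
  using assms by (intro tendsto_Lim tendsto_eventually)

text \<open>\<open>Lim\<close> is a total function, so the eventual constancy stated with it
  certifies that the limit exists; \<open>left_value\<close> is the counterpart.\<close>

lemma right_value:
  assumes "piecewise_constant_control a T u" "0 \<le> s" "s < T"
  shows "\<exists>k\<in>{a, - a, 0}. Lim (at_right s) u = k \<and> (\<forall>\<^sub>F r in at_right s. u r = k)"
proof -
  obtain n \<tau> where \<tau>: "\<tau> 0 = 0" "\<tau> n = T" "\<forall>j<n. \<tau> j < \<tau> (Suc j)"
    "\<forall>j<n. \<exists>k\<in>{a, -a, 0}. \<forall>s\<in>{\<tau> j<..<\<tau> (Suc j)}. u s = k"
    using assms unfolding piecewise_constant_control_def by blast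
  have "s \<in> \<tau> ` {..n} \<or> (\<exists>j<n. s \<in> {\<tau> j<..<\<tau> (Suc j)})"
  proof (rule partition_cover[OF \<tau>(3)])
    show "\<tau> 0 \<le> s" "s \<le> \<tau> n"
      using \<tau>(1,2) assms(2,3) by linarith+
  qed
  then obtain j where j: "j < n" "\<tau> j \<le> s" "s < \<tau> (Suc j)"
  proof
    assume "s \<in> \<tau> ` {..n}"
    then obtain j where "j \<le> n" "s = \<tau> j" by blast
    with assms(3) \<tau>(2) have "j < n" by (cases "j = n") auto
    with \<open>s = \<tau> j\<close> \<tau>(3) that[of j] show thesis by simp
  qed (use that in force)
  then obtain k where k: "k \<in> {a, - a, 0}" "\<forall>s\<in>{\<tau> j<..<\<tau> (Suc j)}. u s = k"
    using \<tau>(4)[rule_format, OF j(1)] by blast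
  have "\<forall>\<^sub>F r in at_right s. u r = k"
    unfolding eventually_at_right_field using j k by (intro exI[of _ "\<tau> (Suc j)"]) auto
  with Lim_eventually[OF this] k(1) show ?thesis by auto
qed

lemma left_value:
  assumes "piecewise_constant_control a T u" "0 < s" "s \<le> T"
  shows "\<exists>k\<in>{a, - a, 0}. Lim (at_left s) u = k \<and> (\<forall>\<^sub>F r in at_left s. u r = k)"
proof -
  obtain n \<tau> where \<tau>: "\<tau> 0 = 0" "\<tau> n = T" "\<forall>j<n. \<tau> j < \<tau> (Suc j)"
    "\<forall>j<n. \<exists>k\<in>{a, -a, 0}. \<forall>s\<in>{\<tau> j<..<\<tau> (Suc j)}. u s = k"
    using assms unfolding piecewise_constant_control_def by blast
  have "s \<in> \<tau> ` {..n} \<or> (\<exists>j<n. s \<in> {\<tau> j<..<\<tau> (Suc j)})"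
  proof (rule partition_cover[OF \<tau>(3)])
    show "\<tau> 0 \<le> s" "s \<le> \<tau> n"
      using \<tau>(1,2) assms(2,3) by linarith+
  qed
  then obtain j where j: "j < n" "\<tau> j < s" "s \<le> \<tau> (Suc j)"
  proof
    assume "s \<in> \<tau> ` {..n}"
    then obtain j where "j \<le> n" "s = \<tau> j" by blast
    with assms(2) \<tau>(1) obtain j' where "j = Suc j'" by (cases j) auto
    with \<open>s = \<tau> j\<close> \<open>j \<le> n\<close> \<tau>(3) that[of j'] show thesis by simp
  qed (use that in force)
  then obtain k where k: "k \<in> {a, - a, 0}" "\<forall>s\<in>{\<tau> j<..<\<tau> (Suc j)}. u s = k"
    using \<tau>(4)[rule_format, OF j(1)] by blast
  have "\<forall>\<^sub>F r in at_left s. u r = k"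
    unfolding eventually_at_left_field using j k by (intro exI[of _ "\<tau> j"]) auto
  with Lim_eventually[OF this] k(1) show ?thesis by auto
qed

lemma finite_switches:
  assumes "piecewise_constant_control a T u"
  shows "finite (switches T u)"
proof -
  have "switches T u \<subseteq> {s\<in>{0..T}. \<not> (u s \<in> {a, - a, 0} \<and> (\<forall>\<^sub>F r in nhds s. u r = u s))}"
  proof
    fix s assume s: "s \<in> switches T u"
    have False if "\<forall>\<^sub>F r in nhds s. u r = u s"
    proof -
      have "\<forall>\<^sub>F r in at_left s. u r = u s" "\<forall>\<^sub>F r in at_right s. u r = u s"
        using that by (auto simp: eventually_at_filter elim: eventually_mono)
      then have "Lim (at_left s) u = u s" "Lim (at_right s) u = u s"
        by (auto intro!: Lim_eventually)
      then show False
        using s unfolding switches_def by simp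
    qed
    then show "s \<in> {s\<in>{0..T}. \<not> (u s \<in> {a, - a, 0} \<and> (\<forall>\<^sub>F r in nhds s. u r = u s))}"
      using s unfolding switches_def by auto
  qed
  then show ?thesis
    using finite_not_locally_constant[OF assms] finite_subset by blast
qed

text \<open>Without switches the right limit \<open>R\<close> is locally constant, hence constant on
  the connected open interval, and \<open>u\<close> differs from it at most at the exceptional times
  and the end points.\<close>

lemma constant_between_switches:
  assumes pcc: "piecewise_constant_control a T u" and cd: "0 \<le> c" "c < d" "d \<le> T"
    and no: "{c<..<d} \<inter> switches T u = {}"
  shows "\<exists>k\<in>{a, - a, 0}. finite {s\<in>{c..d}. u s \<noteq> k}"
proof -
  define R where "R = (\<lambda>s. Lim (at_right s) u)"
  define m where "m = (c + d) / 2"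
  have m: "m \<in> {c<..<d}" using cd by (simp add: m_def)
  have R: "R m = R s" if s: "s \<in> {c<..<d}" for s
  proof (rule connected_local_const[of "{c<..<d}" m s R])
    show "\<forall>r\<in>{c<..<d}. \<forall>\<^sub>F q in at r within {c<..<d}. R r = R q"
    proof
      fix r assume r: "r \<in> {c<..<d}"
      have "\<forall>\<^sub>F q in at_left r. u q = R r" "\<forall>\<^sub>F q in at_right r. u q = R r"
      proof -
        have "0 < r" "r < T" using r cd by auto
        moreover have "r \<notin> switches T u" using r no by blast
        ultimately have "Lim (at_left r) u = R r"
          unfolding switches_def R_def by simp
        then show "\<forall>\<^sub>F q in at_left r. u q = R r" "\<forall>\<^sub>F q in at_right r. u q = R r"
          using left_value[OF pcc, of r] right_value[OF pcc, of r] \<open>0 < r\<close> \<open>r < T\<close>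
          unfolding R_def by auto
      qed
      then have "\<forall>\<^sub>F q in at r. u q = R r"
        by (simp add: eventually_at_split)
      then obtain S where S: "open S" "r \<in> S" "\<forall>q\<in>S. q \<noteq> r \<longrightarrow> u q = R r"
        unfolding eventually_at_topological by blast
      have "R r = R q" if q: "q \<in> S" "q \<noteq> r" for q
      proof -
        have "\<forall>\<^sub>F v in nhds q. v \<in> S - {r}"
          using q S by (intro eventually_nhds_in_open) (auto intro: open_Diff)
        then have "\<forall>\<^sub>F v in at_right q. u v = R r"
          using S(3) by (auto simp: eventually_at_filter elim: eventually_mono)
        then show ?thesis
          unfolding R_def by (intro Lim_eventually[symmetric]) auto
      qed
      then show "\<forall>\<^sub>F q in at r within {c<..<d}. R r = R q"
        unfolding eventually_at_topological using S(1,2) by blast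
    qed
  qed (use m s in auto)
  let ?F = "{s\<in>{0..T}. \<not> (u s \<in> {a, - a, 0} \<and> (\<forall>\<^sub>F r in nhds s. u r = u s))}"
  have "{s\<in>{c..d}. u s \<noteq> R m} \<subseteq> ?F \<union> {c, d}"
  proof
    fix s assume s: "s \<in> {s\<in>{c..d}. u s \<noteq> R m}"
    have "u s = R m" if "\<forall>\<^sub>F r in nhds s. u r = u s" "s \<in> {c<..<d}"
    proof -
      have "\<forall>\<^sub>F r in at_right s. u r = u s"
        using that by (auto simp: eventually_at_filter elim: eventually_mono)
      then have "R s = u s"
        unfolding R_def by (auto intro!: Lim_eventually)
      with R[OF that(2)] show ?thesis by simp
    qed
    then show "s \<in> ?F \<union> {c, d}"
      using s cd by auto
  qed
  then have "finite {s\<in>{c..d}. u s \<noteq> R m}"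
    using finite_not_locally_constant[OF pcc] finite_subset by blast
  moreover have "R m \<in> {a, - a, 0}"
    using right_value[OF pcc, of m] m cd unfolding R_def by auto
  ultimately show ?thesis by blast
qed

lemma eventually_not_in_finite:
  fixes s :: "'a::t1_space"
  assumes "finite F"
  shows "\<forall>\<^sub>F r in at s. r \<notin> F"
proof -
  have "\<forall>\<^sub>F r in nhds s. r \<in> - (F - {s})"
    using assms by (intro eventually_nhds_in_open open_Compl finite_imp_closed) auto
  then show ?thesis
    unfolding eventually_at_filter by eventually_elim auto
qed

lemma Lim_piece_ends:
  fixes u :: "real \<Rightarrow> real"
  assumes "finite {s\<in>{c..d}. u s \<noteq> k}" "c < d"
  shows "Lim (at_left d) u = k" "Lim (at_right c) u = k"
proof -
  have "\<forall>\<^sub>F r in at_left d. r \<notin> {s\<in>{c..d}. u s \<noteq> k}" "\<forall>\<^sub>F r in at_right c. r \<notin> {s\<in>{c..d}. u s \<noteq> k}"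
    using eventually_not_in_finite[OF assms(1)] by (auto simp: eventually_at_split)
  moreover have "\<forall>\<^sub>F r in at_left d. r \<in> {c<..<d}" "\<forall>\<^sub>F r in at_right c. r \<in> {c<..<d}"
    using assms(2) by (auto intro: eventually_at_leftI eventually_at_rightI)
  ultimately have "\<forall>\<^sub>F r in at_left d. u r = k \<and> r \<in> {c<..<d}"
    "\<forall>\<^sub>F r in at_right c. u r = k \<and> r \<in> {c<..<d}"
    unfolding eventually_conj_iff by (auto elim: eventually_elim2)
  then have "\<forall>\<^sub>F r in at_left d. u r = k" "\<forall>\<^sub>F r in at_right c. u r = k"
    by (auto elim: eventually_mono)
  then show "Lim (at_left d) u = k" "Lim (at_right c) u = k"
    by (auto intro!: Lim_eventually)
qed

section \<open>Switches inside a stage\<close>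

lemma next_element:
  fixes X :: "real set"
  assumes "finite X" "s < m"
  obtains s' where "s < s'" "s' \<le> m" "{s<..<s'} \<inter> X = {}"
proof
  let ?Y = "insert m {x\<in>X. s < x}"
  have fin: "finite ?Y" using assms by simp
  then have "Min ?Y \<in> ?Y" by (intro Min_in) auto
  then show "s < Min ?Y" using assms by auto
  show "Min ?Y \<le> m" using fin by simp
  show "{s<..<Min ?Y} \<inter> X = {}"
    using Min_le[OF fin] by force
qed

text \<open>Choosing the smallest elements makes them consecutive, so that no other switch lies
  before or between them.\<close>

lemma three_smallest:
  fixes X :: "real set"
  assumes "finite X" "3 \<le> card X"
  obtains s\<^sub>1 s\<^sub>2 s\<^sub>3 where "{s\<^sub>1, s\<^sub>2, s\<^sub>3} \<subseteq> X" "s\<^sub>1 < s\<^sub>2" "s\<^sub>2 < s\<^sub>3"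
    "\<And>x. x \<in> X \<Longrightarrow> x < s\<^sub>3 \<Longrightarrow> x = s\<^sub>1 \<or> x = s\<^sub>2"
proof -
  define s\<^sub>1 where "s\<^sub>1 = Min X"
  define Y where "Y = X - {s\<^sub>1}"
  define s\<^sub>2 where "s\<^sub>2 = Min Y"
  define Z where "Z = Y - {s\<^sub>2}"
  define s\<^sub>3 where "s\<^sub>3 = Min Z"
  have X: "X \<noteq> {}" using assms by auto
  then have s1: "s\<^sub>1 \<in> X" using assms by (simp add: s\<^sub>1_def)
  have Y: "finite Y" "2 \<le> card Y" using assms s1 by (auto simp: Y_def)
  then have "Y \<noteq> {}" by auto
  then have s2: "s\<^sub>2 \<in> Y" using Y by (simp add: s\<^sub>2_def)
  have Z: "finite Z" "1 \<le> card Z" using Y s2 by (auto simp: Z_def)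
  then have "Z \<noteq> {}" by auto
  then have s3: "s\<^sub>3 \<in> Z" using Z by (simp add: s\<^sub>3_def)
  show thesis
  proof (rule that)
    show "{s\<^sub>1, s\<^sub>2, s\<^sub>3} \<subseteq> X" using s1 s2 s3 by (auto simp: Y_def Z_def)
    show "s\<^sub>1 < s\<^sub>2"
      using s2 Min_le[OF assms(1), of s\<^sub>2] by (auto simp: Y_def s\<^sub>1_def)
    show "s\<^sub>2 < s\<^sub>3"
      using s3 Min_le[OF Y(1), of s\<^sub>3] by (auto simp: Z_def s\<^sub>2_def)
    show "x = s\<^sub>1 \<or> x = s\<^sub>2" if "x \<in> X" "x < s\<^sub>3" for x
      using that Min_le[OF Z(1), of x] by (auto simp: Z_def Y_def s\<^sub>3_def)
  qed
qed

text \<open>Three switches bound four pieces on which the control is constant up to finitely many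
  times. Neighbouring values differ because they are the one-sided limits at a switch, so the pieces
  spell a shortenable word.\<close>

lemma card_switches_stage:
  assumes "0 < a" "\<forall>i\<in>{1..N}. p (i - 1) \<noteq> p i"
    and opt: "optimal N a p \<theta>\<^sub>0 \<theta>\<^sub>f t u x y \<theta>" and pcc: "piecewise_constant_control a (t N) u"
    and i: "i \<in> {1..N}"
  shows "card (switches (t N) u \<inter> {t (i - 1)<..<t i}) \<le> 2"
proof (rule ccontr)
  define X where "X = switches (t N) u \<inter> {t (i - 1)<..<t i}"
  assume "\<not> card (switches (t N) u \<inter> {t (i - 1)<..<t i}) \<le> 2"
  then have "3 \<le> card X" by (simp add: X_def)
  have fin: "finite X"
    using finite_switches[OF pcc] by (simp add: X_def)
  obtain s\<^sub>1 s\<^sub>2 s\<^sub>3 where s: "{s\<^sub>1, s\<^sub>2, s\<^sub>3} \<subseteq> X" "s\<^sub>1 < s\<^sub>2" "s\<^sub>2 < s\<^sub>3"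
    "\<And>x. x \<in> X \<Longrightarrow> x < s\<^sub>3 \<Longrightarrow> x = s\<^sub>1 \<or> x = s\<^sub>2"
    using three_smallest[OF fin \<open>3 \<le> card X\<close>] by metis
  define s\<^sub>0 where "s\<^sub>0 = t (i - 1)"
  have s0: "s\<^sub>0 < s\<^sub>1" and s3: "s\<^sub>3 < t i" using s(1) by (auto simp: s\<^sub>0_def X_def)
  \<comment> \<open>The fourth piece ends at the next switch or, if there is none in the stage, at
    the node \<open>t i\<close>.\<close>
  obtain s\<^sub>4 where s4: "s\<^sub>3 < s\<^sub>4" "s\<^sub>4 \<le> t i" "{s\<^sub>3<..<s\<^sub>4} \<inter> X = {}"
    using next_element[OF fin s3] by metis
  have feas: "feasible N a p \<theta>\<^sub>0 \<theta>\<^sub>f t u x y \<theta>"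
    using opt unfolding optimal_def by blast
  then have t0: "t 0 = 0" and incr: "\<forall>i\<in>{1..N}. t (i - 1) < t i"
    unfolding feasible_def by blast+
  have bounds: "0 \<le> s\<^sub>0" "s\<^sub>4 \<le> t N"
    using nodes_mono[OF incr, of 0 "i - 1"] nodes_mono[OF incr, of i N] t0 i s4 by (auto simp: s\<^sub>0_def)
  have piece: "\<exists>k\<in>{a, - a, 0}. finite {r\<in>{c..d}. u r \<noteq> k}"
    if "s\<^sub>0 \<le> c" "c < d" "d \<le> s\<^sub>4" "{c<..<d} \<inter> X = {}" for c d
    using that bounds s4(2) by (intro constant_between_switches[OF pcc]) (auto simp: s\<^sub>0_def X_def)
  have before: "x \<notin> X" if "x < s\<^sub>3" "x \<noteq> s\<^sub>1" "x \<noteq> s\<^sub>2" for x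
    using s(4) that by blast
  have gap: "{s\<^sub>0<..<s\<^sub>1} \<inter> X = {}" "{s\<^sub>1<..<s\<^sub>2} \<inter> X = {}" "{s\<^sub>2<..<s\<^sub>3} \<inter> X = {}"
    "{s\<^sub>3<..<s\<^sub>4} \<inter> X = {}"
    using before s(2,3) s4(3) by (auto simp: disjoint_iff)
  obtain k\<^sub>0 where k0: "k\<^sub>0 \<in> {a, - a, 0}" "finite {r\<in>{s\<^sub>0..s\<^sub>1}. u r \<noteq> k\<^sub>0}"
    using piece[of s\<^sub>0 s\<^sub>1] gap(1) s(2,3) s0 s4 by auto
  obtain k\<^sub>1 where k1: "k\<^sub>1 \<in> {a, - a, 0}" "finite {r\<in>{s\<^sub>1..s\<^sub>2}. u r \<noteq> k\<^sub>1}"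
    using piece[of s\<^sub>1 s\<^sub>2] gap(2) s(2,3) s0 s4 by auto
  obtain k\<^sub>2 where k2: "k\<^sub>2 \<in> {a, - a, 0}" "finite {r\<in>{s\<^sub>2..s\<^sub>3}. u r \<noteq> k\<^sub>2}"
    using piece[of s\<^sub>2 s\<^sub>3] gap(3) s(2,3) s0 s4 by auto
  obtain k\<^sub>3 where k3: "k\<^sub>3 \<in> {a, - a, 0}" "finite {r\<in>{s\<^sub>3..s\<^sub>4}. u r \<noteq> k\<^sub>3}"
    using piece[of s\<^sub>3 s\<^sub>4] gap(4) s(2,3) s0 s4 by auto
  have "k\<^sub>0 \<noteq> k\<^sub>1" "k\<^sub>1 \<noteq> k\<^sub>2" "k\<^sub>2 \<noteq> k\<^sub>3"
    using Lim_piece_ends[OF k0(2) s0] Lim_piece_ends[OF k1(2) s(2)] Lim_piece_ends[OF k2(2) s(3)]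
      Lim_piece_ends[OF k3(2) s4(1)] s(1) unfolding X_def switches_def by auto
  moreover have "{k\<^sub>0 / a, k\<^sub>1 / a, k\<^sub>2 / a, k\<^sub>3 / a} \<subseteq> {1, -1, 0}"
    using k0 k1 k2 k3 \<open>0 < a\<close> by auto
  ultimately have short: "shortenable [(k\<^sub>0 / a, a * (s\<^sub>1 - s\<^sub>0)), (k\<^sub>1 / a, a * (s\<^sub>2 - s\<^sub>1)),
      (k\<^sub>2 / a, a * (s\<^sub>3 - s\<^sub>2)), (k\<^sub>3 / a, a * (s\<^sub>4 - s\<^sub>3))]" (is "shortenable ?w")
    using \<open>0 < a\<close> s0 s(2,3) s4(1) by (intro shortenable_four_pieces) auto
  have "word ?w"
    using \<open>{k\<^sub>0 / a, k\<^sub>1 / a, k\<^sub>2 / a, k\<^sub>3 / a} \<subseteq> {1, -1, 0}\<close> \<open>0 < a\<close> s0 s(2,3) s4(1) by auto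
  moreover have "follows a u s\<^sub>0 ?w"
    using k0(2) k1(2) k2(2) k3(2) \<open>0 < a\<close> by simp
  moreover have "s\<^sub>0 + word_len ?w / a \<le> t i"
    using \<open>0 < a\<close> s4 by (simp add: add_divide_distrib)
  ultimately have "\<not> shortenable ?w"
    by (intro optimal_not_shortenable[OF assms]) (auto simp: s\<^sub>0_def)
  with short show False by blast
qed

lemma card_switches:
  assumes "0 < a" "\<forall>i\<in>{1..N}. p (i - 1) \<noteq> p i"
    and opt: "optimal N a p \<theta>\<^sub>0 \<theta>\<^sub>f t u x y \<theta>" and pcc: "piecewise_constant_control a (t N) u"
    and nodes: "\<forall>i\<in>{1..N - 1}. Lim (at_right (t i)) u = Lim (at_left (t i)) u"
  shows "card (switches (t N) u) \<le> 2 * N"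
proof -
  have feas: "feasible N a p \<theta>\<^sub>0 \<theta>\<^sub>f t u x y \<theta>"
    using opt unfolding optimal_def by blast
  then have t0: "t 0 = 0" and incr: "\<forall>i\<in>{1..N}. t (i - 1) < t i"
    unfolding feasible_def by blast+
  have incr': "\<forall>j<N. t j < t (Suc j)"
    using incr by force
  have "switches (t N) u \<subseteq> (\<Union>i\<in>{1..N}. switches (t N) u \<inter> {t (i - 1)<..<t i})"
  proof
    fix s assume s: "s \<in> switches (t N) u"
    then have "s \<in> t ` {..N} \<or> (\<exists>j<N. s \<in> {t j<..<t (Suc j)})"
      using t0 by (intro partition_cover[OF incr']) (auto simp: switches_def)
    moreover have "s \<notin> t ` {..N}"
    proof
      assume "s \<in> t ` {..N}"
      then obtain j where j: "j \<le> N" "s = t j" by blast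
      with s t0 have "j \<noteq> 0" "j \<noteq> N"
        by (auto simp: switches_def intro: gr0I)
      then have "j \<in> {1..N - 1}" using j by simp
      with s j nodes show False by (simp add: switches_def)
    qed
    ultimately obtain j where "j < N" "s \<in> {t j<..<t (Suc j)}" by blast
    then show "s \<in> (\<Union>i\<in>{1..N}. switches (t N) u \<inter> {t (i - 1)<..<t i})"
      using s by (intro UN_I[of "Suc j"]) auto
  qed
  then have "card (switches (t N) u) \<le> card (\<Union>i\<in>{1..N}. switches (t N) u \<inter> {t (i - 1)<..<t i})"
    using finite_switches[OF pcc] by (intro card_mono) auto
  also have "\<dots> \<le> (\<Sum>i\<in>{1..N}. card (switches (t N) u \<inter> {t (i - 1)<..<t i}))"
    by (intro card_UN_le) simp
  also have "\<dots> \<le> (\<Sum>i\<in>{1..N}. 2)"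
    by (intro sum_mono card_switches_stage[OF assms(1-4)])
  finally show ?thesis by simp
qed

section \<open>Maximal pieces and their starting times\<close>

lemma AE_lebesgue_on_iff_negligible:
  fixes S :: "'a::euclidean_space set"
  assumes "S \<in> sets lebesgue"
  shows "(AE s in lebesgue_on S. P s) \<longleftrightarrow> negligible {s\<in>S. \<not> P s}"
proof -
  have "(AE s in lebesgue_on S. P s) \<longleftrightarrow> (AE s in lebesgue. s \<in> S \<longrightarrow> P s)"
    using assms by (simp add: AE_restrict_space_iff)
  also have "\<dots> \<longleftrightarrow> {s. \<not> (s \<in> S \<longrightarrow> P s)} \<in> null_sets lebesgue"
    by (simp add: completion.AE_iff_null_sets)
  finally show ?thesis
    by (simp add: negligible_iff_null_sets)
qed

lemma constant_piece_iff:
  "constant_piece T u k c d \<longleftrightarrow> 0 \<le> c \<and> c < d \<and> d \<le> T \<and> negligible {s\<in>{c..d}. u s \<noteq> k}"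
  unfolding constant_piece_def by (simp add: AE_lebesgue_on_iff_negligible)

text \<open>Otherwise a nonempty open interval to the right of \<open>c\<close> would be contained
  in the negligible set of exceptions.\<close>

lemma constant_piece_value:
  assumes "constant_piece T u k c d" "\<forall>\<^sub>F r in at_right c. u r = k'"
  shows "k = k'"
proof (rule ccontr)
  assume "k \<noteq> k'"
  obtain b where b: "c < b" "\<And>r. c < r \<Longrightarrow> r < b \<Longrightarrow> u r = k'"
    using assms(2) unfolding eventually_at_right_field by blast
  have "{c<..<min b d} \<subseteq> {s\<in>{c..d}. u s \<noteq> k}"
    using b \<open>k \<noteq> k'\<close> by auto
  then have "negligible {c<..<min b d}"
    using assms(1) negligible_subset unfolding constant_piece_iff by blast
  moreover have "{c<..<min b d} \<noteq> {}"
    using b assms(1) by (auto simp: constant_piece_def)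
  ultimately show False
    using open_not_negligible[of "{c<..<min b d}"] by auto
qed

text \<open>At any other starting time the left limit agrees with the right limit, which is the
  value of the piece, so the piece could be extended to the left.\<close>

lemma maximal_piece_start:
  assumes pcc: "piecewise_constant_control a T u" and max: "maximal_piece T u k c d"
  shows "c \<in> insert 0 (switches T u)"
proof (rule ccontr)
  assume c: "c \<notin> insert 0 (switches T u)"
  have cp: "constant_piece T u k c d"
    using max unfolding maximal_piece_def by blast
  then have cd: "0 < c" "c < d" "d \<le> T"
    using c unfolding constant_piece_def by auto
  have "k = Lim (at_right c) u"
    using right_value[OF pcc, of c] cd by (intro constant_piece_value[OF cp]) auto
  also have "\<dots> = Lim (at_left c) u"
    using c cd unfolding switches_def by auto
  finally have "\<forall>\<^sub>F r in at_left c. u r = k"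
    using left_value[OF pcc, of c] cd by auto
  then obtain b where b: "b < c" "\<And>r. b < r \<Longrightarrow> r < c \<Longrightarrow> u r = k"
    unfolding eventually_at_left_field by blast
  define c' where "c' = max b 0"
  have c': "0 \<le> c'" "c' < c" using b cd by (auto simp: c'_def)
  \<comment> \<open>At \<open>c'\<close> itself the value of \<open>u\<close> is unknown; the single
    point is added as a negligible exception.\<close>
  have "{s\<in>{c'..d}. u s \<noteq> k} \<subseteq> {c'} \<union> {s\<in>{c..d}. u s \<noteq> k}"
  proof
    fix s assume s: "s \<in> {s\<in>{c'..d}. u s \<noteq> k}"
    have "s = c'" if "s < c"
      using that b(2)[of s] s by (force simp: c'_def max_def not_less)
    then show "s \<in> {c'} \<union> {s\<in>{c..d}. u s \<noteq> k}"
      using s by (cases "s < c") auto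
  qed
  moreover have "negligible ({c'} \<union> {s\<in>{c..d}. u s \<noteq> k})"
    using cp unfolding constant_piece_iff by (intro negligible_Un) auto
  ultimately have "negligible {s\<in>{c'..d}. u s \<noteq> k}"
    using negligible_subset by blast
  then have "constant_piece T u k c' d"
    unfolding constant_piece_iff using c' cd by simp
  moreover have "{c..d} \<subseteq> {c'..d}"
    using c' by simp
  ultimately have "{c'..d} = {c..d}"
    using max unfolding maximal_piece_def by blast
  then show False
    using c' cd by auto
qed

text \<open>Both values equal the right limit at \<open>c\<close>, and of two intervals with the
  same start one contains the other, so maximality makes them equal.\<close>

lemma maximal_piece_start_unique:
  assumes pcc: "piecewise_constant_control a T u"
    and max: "maximal_piece T u k c d" "maximal_piece T u k' c d'"
  shows "d = d'"
proof -
  have cp: "constant_piece T u k c d" "constant_piece T u k' c d'"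
    using max unfolding maximal_piece_def by blast+
  then have c: "0 \<le> c" "c < T"
    unfolding constant_piece_def by auto
  have "k = Lim (at_right c) u" "k' = Lim (at_right c) u"
    using right_value[OF pcc c] cp by (auto intro!: constant_piece_value)
  then have "k = k'" by simp
  have "c < d" "c < d'"
    using cp unfolding constant_piece_def by auto
  show ?thesis
  proof (cases "d \<le> d'")
    case True
    then have "{c..d} \<subseteq> {c..d'}" by simp
    then have "{c..d'} = {c..d}"
      using max(1) cp(2) \<open>k = k'\<close> unfolding maximal_piece_def by blast
    then show ?thesis using \<open>c < d\<close> by auto
  next
    case False
    then have "{c..d'} \<subseteq> {c..d}" by simp
    then have "{c..d} = {c..d'}"
      using max(2) cp(1) \<open>k = k'\<close> unfolding maximal_piece_def by blast
    then show ?thesis using \<open>c < d'\<close> by auto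
  qed
qed

theorem proposition1:
  fixes N :: nat and a :: real and p :: "nat \<Rightarrow> real \<times> real" and \<theta>\<^sub>0 \<theta>\<^sub>f :: real
    and t :: "nat \<Rightarrow> real" and u x y \<theta> :: "real \<Rightarrow> real"
  assumes "N \<ge> 1" and "a > 0"
    and "\<forall>i\<in>{1..N}. p (i - 1) \<noteq> p i"
    and "optimal N a p \<theta>\<^sub>0 \<theta>\<^sub>f t u x y \<theta>"
    and "piecewise_constant_control a (t N) u"
    and "\<forall>i\<in>{1..N - 1}. Lim (at_right (t i)) u = Lim (at_left (t i)) u"
  shows "finite (C_subarcs a (t N) u \<union> S_subarcs (t N) u) \<and>
    card (C_subarcs a (t N) u \<union> S_subarcs (t N) u) \<le> 2 * N + 1"
proof -
  let ?Q = "C_subarcs a (t N) u \<union> S_subarcs (t N) u" and ?S = "insert 0 (switches (t N) u)"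
  have Q: "\<exists>k. maximal_piece (t N) u k c d" if "(c, d) \<in> ?Q" for c d
    using that unfolding C_subarcs_def S_subarcs_def by auto
  \<comment> \<open>The starting time fixes the value of the control as well, so injectivity holds
    across \<open>C\<close> and \<open>S\<close> pieces together.\<close>
  have inj: "inj_on fst ?Q"
    using Q maximal_piece_start_unique[OF assms(5)] unfolding inj_on_def by (metis prod.collapse)
  have sub: "fst ` ?Q \<subseteq> ?S"
    using Q maximal_piece_start[OF assms(5)] by (force simp del: insert_iff Un_iff)
  have fin: "finite ?S"
    using finite_switches[OF assms(5)] by simp
  have "card ?Q \<le> card ?S"
    using inj sub fin by (rule card_inj_on_le)
  also have "\<dots> \<le> Suc (card (switches (t N) u))"
    by (rule card_insert_le_m1) auto
  also have "\<dots> \<le> 2 * N + 1"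
    using card_switches[OF assms(2-6)] by simp
  finally show ?thesis
    using finite_imageD[OF finite_subset[OF sub fin] inj] by blast
qed

end
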